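(* Let $\mathbb{T}$ be a time scale, $a,b\in\mathbb{T}$ with $a<b$, and $\mathbb{T}_\ast:=[a,b]_{\mathbb{T}}$. Let $u:\mathbb{T}_\ast\to\mathbb{R}$ and $f:\mathbb{T}_\ast^{\kappa}\to\mathbb{R}$ be nonnegative rd-continuous functions. Let $k:\mathbb{T}_\ast\times\mathbb{T}_\ast^{\kappa}\to\mathbb{R}$ be an admissible kernel (as defined in the context) such that $k(t,s)$ and $k^{\Delta_1}(t,s)$ are nonnegative for every $t,s\in\mathbb{T}_\ast$ with $s\leq t$ for which they are defined, and assume that $k$ is not identically zero on $\mathbb{T}_\ast^{\kappa}\times\mathbb{T}_\ast^{\kappa^2}$. Let $\Phi\in C(\mathbb{R}^+_0,\mathbb{R}^+_0)$ be a nondecreasing, subadditive and submultiplicative function such that $\Phi(x)>0$ for $x>0$, and let $W\in C(\mathbb{R}^+_0,\mathbb{R}^+_0)$ be a nondecreasing function such that $W(x)>0$ for $x>0$. Let $a(\cdot):\mathbb{T}_\ast\to(0,\infty)$ be a positive, rd-continuous and nondecreasing function. Suppose that for all $t\in\mathbb{T}_\ast$ $$u(t)\leq a(t)+\int_a^t f(s)u(s)\Delta s+\int_a^t f(s)W\left(\int_a^s k(s,\tau)\Phi(u(\tau))\Delta\tau\right)\Delta s.$$ Define $$p(t)=1+\int_a^t f(s)e_f(t,\sigma(s))\Delta s,\qquad \zeta=\int_a^{\rho(b)}k(\rho(b),s)\Phi(p(s)a(s))\Delta s,$$ $$\Psi(x)=\int_{x_0}^x\frac{1}{\Phi(W(s))}\,ds,\quad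 x>0,\ x_0>0,$$ and let $\Psi^{-1}$ be the inverse of $\Psi$. Then for all $t\in\mathbb{T}_\ast$ satisfying $$\Psi(\zeta)+\int_a^{\rho(t)}k(\rho(t),s)\Phi(p(s))\Phi\left(\int_a^s f(\tau)\Delta\tau\right)\Delta s\in \mathrm{Dom}(\Psi^{-1})$$ we have $$u(t)\leq p(t)a(t)+p(t)\int_a^t f(s)W\left[\Psi^{-1}\left(\Psi(\zeta)+\int_a^s k(s,\tau)\Phi(p(\tau))\Phi\left(\int_a^\tau f(\theta)\Delta\theta\right)\Delta\tau\right)\right]\Delta s.$$
   Context: A time scale $\mathbb{T}$ is a nonempty closed subset of $\mathbb{R}$. $\mathbb{R}^+_0=[0,\infty)$. For $a<b$ in $\mathbb{T}$, $[a,b]_{\mathbb{T}}=\{t\in\mathbb{T}:a\leq t\leq b\}$, and $\mathbb{T}_\ast=[a,b]_{\mathbb{T}}$ is regarded as a time scale itself. On $\mathbb{T}_\ast$: $\sigma(t)=\inf\{s\in\mathbb{T}_\ast:s>t\}$ (with $\sigma(b)=b$), $\rho(t)=\sup\{s\in\mathbb{T}_\ast:s<t\}$ (with $\rho(a)=a$), $\mu(t)=\sigma(t)-t$. $\mathbb{T}_\ast^{\kappa}=\mathbb{T}_\ast\setminus\{b\}$ if $\rho(b)<b$ and $\mathbb{T}_\ast^{\kappa}=\mathbb{T}_\ast$ otherwise; $\mathbb{T}_\ast^{\kappa^2}=(\mathbb{T}_\ast^{\kappa})^{\kappa}$. $f^\Delta$ denotes the (Hilger) delta derivative and $\int\cdot\,\Delta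 s$ the delta integral. A function is rd-continuous if it is continuous at right-dense points ($\sigma(t)=t$) and has finite left-sided limits at left-dense points ($\rho(t)=t$). For $f\ge 0$ rd-continuous, $e_f(\cdot,s)$ is the time scale exponential function: the unique solution of $y^\Delta=f y$, $y(s)=1$. Admissible kernel: $k:\mathbb{T}_\ast\times\mathbb{T}_\ast^{\kappa}\to\mathbb{R}$ satisfies, for each $t\in\mathbb{T}_\ast^{\kappa}$ with $t>a$: $k$ is continuous at $(t,t)$; the delta derivative $k^{\Delta_1}(t,\cdot)$ of $k$ with respect to its first variable is rd-continuous on $[a,\sigma(t)]$ (where defined); and for each $\varepsilon>0$ there is a neighborhood $U$ of $t$, independent of $\tau\in[a,\sigma(t)]$, such that $|k(\sigma(t),\tau)-k(s,\tau)-k^{\Delta_1}(t,\tau)(\sigma(t)-s)|\le\varepsilon|\sigma(t)-s|$ for all $s\in U$. The delta integrals appearing in the statement are understood to exist. Subadditive: $\Phi(x+y)\le\Phi(x)+\Phi(y)$; submultiplicative: $\Phi(xy)\le\Phi(x)\Phi(y)$, for all $x,y\ge0$. $\Psi$ is defined on $(0,\infty)$ with a fixed $x_0>0$, and $\mathrm{Dom}(\Psi^{-1})$ is the range of $\Psi$. The function $a(\cdot)$, always written with an argument, is distinct from the endpoint $a$. *)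

theory Defs
  imports "HOL-Analysis.Analysis"
begin

definition time_scale :: "real set \<Rightarrow> bool" where
  "time_scale T \<longleftrightarrow> T \<noteq> {} \<and> closed T"

definition ts_sigma :: "real set \<Rightarrow> real \<Rightarrow> real" where
  "ts_sigma T t = (if \<exists>s\<in>T. t < s then Inf {s \<in> T. t < s} else t)"

definition ts_rho :: "real set \<Rightarrow> real \<Rightarrow> real" where
  "ts_rho T t = (if \<exists>s\<in>T. s < t then Sup {s \<in> T. s < t} else t)"

definition ts_kappa :: "real set \<Rightarrow> real set" where
  "ts_kappa T = {t \<in> T. \<not> ((\<forall>s\<in>T. s \<le> t) \<and> ts_rho T t < t)}"

text \<open>Functions are total in HOL, so a function on a subset \<open>S\<close> of the time scale \<open>T\<close> is
  given together with \<open>S\<close>. Whether a point is left- or right-dense is decided in \<open>T\<close>,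
  limits are taken in \<open>S\<close>. At the minimum of \<open>T\<close> the left-sided limit condition is void.\<close>

definition rd_continuous_on :: "real set \<Rightarrow> real set \<Rightarrow> (real \<Rightarrow> real) \<Rightarrow> bool" where
  "rd_continuous_on T S g \<longleftrightarrow>
     (\<forall>t\<in>S. (ts_sigma T t = t \<longrightarrow> continuous (at t within S) g) \<and>
            (ts_rho T t = t \<longrightarrow> (\<exists>l. (g \<longlongrightarrow> l) (at t within S \<inter> {..<t}))))"

definition has_delta_derivative ::
    "real set \<Rightarrow> (real \<Rightarrow> real) \<Rightarrow> real \<Rightarrow> real \<Rightarrow> bool" where
  "has_delta_derivative T g D t \<longleftrightarrow>
     (\<forall>\<epsilon>>0. \<exists>\<delta>>0. \<forall>s\<in>T. \<bar>s - t\<bar> < \<delta> \<longrightarrow>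
        \<bar>g (ts_sigma T t) - g s - D * (ts_sigma T t - s)\<bar> \<le> \<epsilon> * \<bar>ts_sigma T t - s\<bar>)"

definition delta_differentiable :: "real set \<Rightarrow> (real \<Rightarrow> real) \<Rightarrow> real \<Rightarrow> bool" where
  "delta_differentiable T g t \<longleftrightarrow> (\<exists>D. has_delta_derivative T g D t)"

definition delta_deriv :: "real set \<Rightarrow> (real \<Rightarrow> real) \<Rightarrow> real \<Rightarrow> real" where
  "delta_deriv T g t = (THE D. has_delta_derivative T g D t)"

text \<open>The delta integral is the Cauchy integral of Bohner and Peterson: the increment of a
  (pre-)antiderivative, i.e. of a continuous \<open>G\<close> with \<open>G\<^sup>\<Delta> = g\<close> on \<open>T\<^sup>\<kappa>\<close> outside a countable
  set that contains no right-scattered point. An antiderivative is the case \<open>E = {}\<close>.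
  The integral from \<open>c\<close> to \<open>d\<close> regards \<open>T \<inter> {c..d}\<close> as a time scale itself, so that only the
  values of \<open>g\<close> on \<open>T \<inter> {c..d}\<close> matter. In that time scale \<open>d\<close> is not right-scattered, hence may
  belong to \<open>E\<close>; thus an antiderivative on \<open>T\<close> always restricts to a pre-antiderivative.\<close>

definition pre_antiderivative :: "real set \<Rightarrow> (real \<Rightarrow> real) \<Rightarrow> (real \<Rightarrow> real) \<Rightarrow> bool" where
  "pre_antiderivative T g G \<longleftrightarrow> continuous_on T G \<and>
     (\<exists>E. countable E \<and> (\<forall>t\<in>E. ts_sigma T t = t) \<and>
          (\<forall>t \<in> ts_kappa T - E. has_delta_derivative T G (g t) t))"

definition has_delta_integral ::
    "real set \<Rightarrow> (real \<Rightarrow> real) \<Rightarrow> real \<Rightarrow> real \<Rightarrow> real \<Rightarrow> bool" where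
  "has_delta_integral T g I c d \<longleftrightarrow>
     (\<exists>G. pre_antiderivative (T \<inter> {c..d}) g G \<and> I = G d - G c)"

definition delta_integrable :: "real set \<Rightarrow> (real \<Rightarrow> real) \<Rightarrow> real \<Rightarrow> real \<Rightarrow> bool" where
  "delta_integrable T g c d \<longleftrightarrow> (\<exists>I. has_delta_integral T g I c d)"

definition delta_integral :: "real set \<Rightarrow> real \<Rightarrow> real \<Rightarrow> (real \<Rightarrow> real) \<Rightarrow> real" where
  "delta_integral T c d g = (THE I. has_delta_integral T g I c d)"

text \<open>The value at \<open>t\<close> of the unique solution of \<open>y\<^sup>\<Delta> = f y\<close>, \<open>y s = 1\<close>. The description is of
  the value, since a solution is determined on \<open>T\<close> only.\<close>

definition ts_exp :: "real set \<Rightarrow> (real \<Rightarrow> real) \<Rightarrow> real \<Rightarrow> real \<Rightarrow> real" where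
  "ts_exp T f t s =
     (THE v. \<exists>y. (\<forall>x \<in> ts_kappa T. has_delta_derivative T y (f x * y x) x) \<and> y s = 1 \<and> v = y t)"

text \<open>Kernels on \<open>T \<times> T\<^sup>\<kappa>\<close>, where \<open>a\<close> is the minimum of \<open>T\<close>. The last clause says in particular
  that \<open>k(\<cdot>, \<tau>)\<close> is delta differentiable at \<open>t\<close> with derivative \<open>kdelta T k t \<tau>\<close>.\<close>

definition kdelta :: "real set \<Rightarrow> (real \<Rightarrow> real \<Rightarrow> real) \<Rightarrow> real \<Rightarrow> real \<Rightarrow> real" where
  "kdelta T k t \<tau> = delta_deriv T (\<lambda>x. k x \<tau>) t"

definition admissible_kernel :: "real set \<Rightarrow> real \<Rightarrow> (real \<Rightarrow> real \<Rightarrow> real) \<Rightarrow> bool" where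
  "admissible_kernel T a k \<longleftrightarrow>
     (\<forall>t \<in> ts_kappa T. a < t \<longrightarrow>
        continuous (at (t, t) within T \<times> ts_kappa T) (\<lambda>(x, y). k x y) \<and>
        rd_continuous_on T (ts_kappa T \<inter> {a..ts_sigma T t}) (kdelta T k t) \<and>
        (\<forall>\<epsilon>>0. \<exists>\<delta>>0. \<forall>\<tau> \<in> ts_kappa T \<inter> {a..ts_sigma T t}. \<forall>s\<in>T. \<bar>s - t\<bar> < \<delta> \<longrightarrow>
           \<bar>k (ts_sigma T t) \<tau> - k s \<tau> - kdelta T k t \<tau> * (ts_sigma T t - s)\<bar>
             \<le> \<epsilon> * \<bar>ts_sigma T t - s\<bar>))"

end

(* Let v(s) be the integral of k(s, tau) Phi(u(tau)) from a to s. Since k is nondecreasing in its first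
   variable, v is nondecreasing, and Gronwall's inequality with e_f(t, a) = p(t) gives
   u(t) <= p(t) (A(t) + int_a^t f W(v)). Applying Phi and using
   int_a^tau f W(v) <= W(v(tau)) int_a^tau f, one finds for t <= t0 that the antiderivative G of
   k(t0, .) Phi(u), which dominates v on [a, t0] and equals v(t0) at t0, satisfies
   G^Delta <= K^Delta + H^Delta Phi(W(G)), where K(t0) <= zeta and H(t0) = g(t0) - Psi(zeta).
   As Psi is concave, Psi(max(G - K + zeta, zeta)) - H is nonincreasing; hence
   Psi(max(v(t0), zeta)) <= g(t0), which bounds v by Psi^-1(g). *)
theory Submission
  imports Defs
begin

section \<open>Monotonicity from right increments\<close>

text \<open>An integral here is the increment of a function whose derivative is prescribed only off
  a countable set and only on a truncated scale. Comparison of integrals, Gronwall's inequality and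
  the nonlinear comparison therefore all rest on one monotonicity criterion, which tolerates
  countably many right-dense exceptions and looks only at increments to the right. Such increments
  treat jumps and limits alike, and this shapes the nonlinear step: the chain rule breaks down
  across a jump, whereas the tangent inequality of a concave function bounds increments of every
  size. The kernels are frozen at different points. K has first argument \<rho>(b), the largest one
  possible, so that its total \<zeta> does not depend on t0; G and H have first argument t0, so that
  they end at the values wanted there. Since e_f is a definite description, its identification with
  p presupposes that the initial value problem is solvable. The solution is built as the exponential
  of an explicit exponent, which then also serves as integrating factor in Gronwall's
  inequality.\<close>

lemma ts_sigma_props:
  assumes "closed S" "s \<in> S" "t < s"
  shows "ts_sigma S t \<in> S" "t \<le> ts_sigma S t" "\<And>r. r \<in> S \<Longrightarrow> t < r \<Longrightarrow> ts_sigma S t \<le> r"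
proof -
  let ?R = "{s \<in> S. t < s}"
  have ne: "?R \<noteq> {}" and bdd: "bdd_below ?R"
    using assms by (auto intro: bdd_belowI[of _ t])
  have eq: "ts_sigma S t = Inf ?R"
    using assms unfolding ts_sigma_def by auto
  have "Inf ?R \<in> closure ?R"
    by (rule closure_contains_Inf[OF ne bdd])
  also have "\<dots> \<subseteq> S"
    using \<open>closed S\<close> by (intro closure_minimal) auto
  finally show "ts_sigma S t \<in> S"
    by (simp add: eq)
  show "t \<le> ts_sigma S t"
    unfolding eq using ne by (intro cInf_greatest) auto
  show "ts_sigma S t \<le> r" if "r \<in> S" "t < r" for r
    unfolding eq using that bdd by (intro cInf_lower) auto
qed

lemma ts_sigma_max: "(\<And>s. s \<in> S \<Longrightarrow> s \<le> t) \<Longrightarrow> ts_sigma S t = t"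
  unfolding ts_sigma_def by force

lemma ts_sigma_ge: "closed S \<Longrightarrow> t \<le> ts_sigma S t"
proof (cases "\<exists>s\<in>S. t < s")
  case False
  then show ?thesis unfolding ts_sigma_def by simp
qed (use ts_sigma_props(2) in blast)

lemma right_dense_approx:
  assumes "closed S" "s \<in> S" "t < s" "ts_sigma S t = t" "0 < \<delta>"
  shows "\<exists>r\<in>S. t < r \<and> r < t + \<delta>"
proof (rule ccontr)
  assume *: "\<not> ?thesis"
  have "Inf {s \<in> S. t < s} \<ge> t + \<delta>"
    using * assms by (intro cInf_greatest) force+
  moreover have "ts_sigma S t = Inf {s \<in> S. t < s}"
    using assms(2,3) by (auto simp: ts_sigma_def)
  ultimately show False using assms by simp
qed

lemma ts_kappa_less: "t \<in> S \<Longrightarrow> s \<in> S \<Longrightarrow> t < s \<Longrightarrow> t \<in> ts_kappa S"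
  unfolding ts_kappa_def by force

lemma ts_kappa_subset: "ts_kappa S \<subseteq> S"
  unfolding ts_kappa_def by auto

text \<open>An integral up to \<open>s\<close> lives on the truncated scale. Cutting changes the
  forward jump of a remaining point only at \<open>s\<close>, which becomes the maximum; hence the
  strict \<open>t < s\<close>.\<close>

lemma ts_sigma_restrict:
  assumes "closed S" "t \<in> S" "s \<in> S" "r \<le> t" "t < s"
  shows "ts_sigma (S \<inter> {r..s}) t = ts_sigma S t"
proof -
  note p = ts_sigma_props[OF assms(1,3,5)]
  have cl: "closed (S \<inter> {r..s})" using assms by auto
  have s: "s \<in> S \<inter> {r..s}" using assms by auto
  note q = ts_sigma_props[OF cl s assms(5)]
  show ?thesis
  proof (rule antisym)
    show "ts_sigma S t \<le> ts_sigma (S \<inter> {r..s}) t"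
    proof (cases "t < ts_sigma (S \<inter> {r..s}) t")
      case True then show ?thesis using p q by auto
    next
      case False
      then have eq: "ts_sigma (S \<inter> {r..s}) t = t" using q by auto
      show ?thesis
      proof (rule ccontr)
        assume "\<not> ?thesis"
        then obtain x where "x \<in> S \<inter> {r..s}" "t < x" "x < t + (ts_sigma S t - t)"
          using right_dense_approx[OF cl s assms(5) eq, of "ts_sigma S t - t"] eq by auto
        then show False using p(3)[of x] by auto
      qed
    qed
    show "ts_sigma (S \<inter> {r..s}) t \<le> ts_sigma S t"
    proof (cases "t < ts_sigma S t")
      case True
      then show ?thesis
        using p assms by (intro q(3)) (auto intro: p(3))
    next
      case False
      then have eq: "ts_sigma S t = t" using p by auto
      show ?thesis
      proof (rule ccontr)
        assume "\<not> ?thesis"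
        then have "0 < min (s - t) (ts_sigma (S \<inter> {r..s}) t - t)" using eq assms by auto
        from right_dense_approx[OF assms(1,3,5) eq this]
        obtain x where "x \<in> S" "t < x" "x < t + min (s - t) (ts_sigma (S \<inter> {r..s}) t - t)" by auto
        then show False using q(3)[of x] assms(2-5) by (auto simp: min_def split: if_splits)
      qed
    qed
  qed
qed

lemma continuous_within_realD:
  fixes F :: "real \<Rightarrow> real"
  assumes "continuous (at t within S) F" "0 < \<epsilon>"
  shows "\<exists>\<delta>>0. \<forall>s\<in>S. \<bar>s - t\<bar> < \<delta> \<longrightarrow> \<bar>F s - F t\<bar> \<le> \<epsilon>"
  using assms unfolding continuous_within_eps_delta dist_real_def by (meson less_imp_le)

text \<open>Dieudonne's mean value argument on a time scale. The relation
  \<open>F t \<le> F c + \<epsilon> * (t - c)\<close> is propagated to the right; at each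
  exceptional point, where no slope is known, it is relaxed by one term of a convergent series.
  Exceptional points are right-dense, so continuity makes the loss just behind them as small as that
  term; across a jump it could not.\<close>

lemma nonincreasing_if_right_increments:
  fixes F :: "real \<Rightarrow> real"
  assumes S: "closed S" "S \<subseteq> {c..d}" "c \<in> S" "d \<in> S"
    and F: "continuous_on S F"
    and E: "countable E" "\<And>t. t \<in> E \<Longrightarrow> ts_sigma S t = t"
    and step: "\<And>t \<epsilon>. t \<in> S \<Longrightarrow> t < d \<Longrightarrow> t \<notin> E \<Longrightarrow> 0 < \<epsilon> \<Longrightarrow>
      \<exists>s\<in>S. t < s \<and> (\<forall>r\<in>S. t < r \<and> r \<le> s \<longrightarrow> F r - F t \<le> \<epsilon> * (r - t))"
  shows "F d \<le> F c"
proof -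
  \<comment> \<open>Inserting \<open>c\<close> leaves something to enumerate when \<open>E\<close>
    is empty. The strict \<open>en n < t\<close> below releases the allowance \<open>(1/2)^n\<close>
    only behind the n-th exceptional point, where it is spent.\<close>
  define en where "en = from_nat_into (insert c E)"
  define j where "j t n = (if en n < t then (1/2)^n else 0 :: real)" for t n
  define J where "J t = (\<Sum>n. j t n)" for t
  have sm_half: "summable (\<lambda>n. (1/2)^n :: real)" by (simp add: summable_geometric)
  have sm: "summable (j t)" for t
    by (rule summable_comparison_test'[OF sm_half, of 0]) (auto simp: j_def)
  have J_nn: "0 \<le> J t" for t
    unfolding J_def by (rule suminf_nonneg[OF sm]) (auto simp: j_def)
  have "J t \<le> (\<Sum>n. (1/2)^n)" for t
    unfolding J_def by (rule suminf_le[OF _ sm sm_half]) (auto simp: j_def)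
  then have J_le: "J t \<le> 2" for t
    by (simp add: suminf_geometric)
  have J_mono: "J s \<le> J t" if "s \<le> t" for s t
    unfolding J_def by (rule suminf_le[OF _ sm sm]) (use that in \<open>auto simp: j_def\<close>)
  have J_jump: "J (en n) + (1/2)^n \<le> J t" if "en n < t" for n t
  proof -
    have "(\<lambda>m. j (en n) m + (if m = n then (1/2)^m else 0)) sums (J (en n) + (1/2)^n)"
      unfolding J_def by (intro sums_add summable_sums[OF sm] sums_single)
    moreover have "j t sums J t"
      unfolding J_def by (intro summable_sums[OF sm])
    ultimately show ?thesis
      by (rule sums_le[rotated]) (use that in \<open>auto simp: j_def\<close>)
  qed
  have bound: "F d \<le> F c + \<epsilon> * (d - c) + \<epsilon> * 2" if \<epsilon>: "0 < \<epsilon>" for \<epsilon>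
  proof -
    define P where "P t \<longleftrightarrow> F t \<le> F c + \<epsilon> * (t - c) + \<epsilon> * J t" for t
    define B where "B = {t \<in> S. \<forall>r\<in>S. r \<le> t \<longrightarrow> P r}"
    have c: "c \<in> B"
    proof -
      have "r = c" if "r \<in> S" "r \<le> c" for r using that S(2) by force
      moreover have "P c" using J_nn[of c] \<epsilon> by (simp add: P_def)
      ultimately show ?thesis using S(3) unfolding B_def by blast
    qed
    have bdd: "bdd_above B"
      using S by (auto simp: B_def intro!: bdd_aboveI[of _ d])
    define m where "m = Sup B"
    have "m \<in> closure B"
      unfolding m_def using c bdd by (intro closure_contains_Sup) auto
    then have mS: "m \<in> S"
      using S closure_minimal[of B S] by (auto simp: B_def)
    have below: "P r" if "r \<in> S" "r < m" for r
    proof -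
      obtain t where "t \<in> B" "r < t"
        using \<open>r < m\<close> c less_cSup_iff[OF _ bdd, of r] unfolding m_def by blast
      then show ?thesis using that by (auto simp: B_def)
    qed
    have cont: "continuous (at m within S) F"
      using F mS by (simp add: continuous_on_eq_continuous_within)
    have Pm: "P m"
    proof (rule ccontr)
      assume "\<not> P m"
      then have "m \<notin> B" using mS by (auto simp: B_def)
      define \<eta> where "\<eta> = (F m - (F c + \<epsilon> * (m - c) + \<epsilon> * J m)) / 2"
      have "0 < \<eta>" using \<open>\<not> P m\<close> by (auto simp: P_def \<eta>_def)
      then obtain \<delta> where \<delta>: "0 < \<delta>" "\<And>s. s \<in> S \<Longrightarrow> \<bar>s - m\<bar> < \<delta> \<Longrightarrow> \<bar>F s - F m\<bar> \<le> \<eta>"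
        using continuous_within_realD[OF cont] by meson
      have "m - \<delta> < Sup B" using \<delta> m_def by auto
      then obtain t where t: "t \<in> B" "m - \<delta> < t"
        using c less_cSup_iff[OF _ bdd, of "m - \<delta>"] by blast
      have tm: "t \<le> m" unfolding m_def using t bdd by (intro cSup_upper)
      have "t \<in> S" "P t" using t by (auto simp: B_def)
      with \<delta>(2)[of t] t tm have "F m - \<eta> \<le> F t" by auto
      also have "\<dots> \<le> F c + \<epsilon> * (t - c) + \<epsilon> * J t" using \<open>P t\<close> by (simp add: P_def)
      also have "\<dots> \<le> F c + \<epsilon> * (m - c) + \<epsilon> * J m"
        using \<epsilon> tm J_mono[OF tm] by (intro add_mono mult_left_mono) auto
      finally show False using \<open>0 < \<eta>\<close> by (simp add: \<eta>_def field_simps)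
    qed
    have "m = d"
    proof (rule ccontr)
      assume "m \<noteq> d"
      then have md: "m < d" using mS S by force
      have "\<exists>s\<in>S. m < s \<and> (\<forall>r\<in>S. m < r \<and> r \<le> s \<longrightarrow> P r)"
      proof (cases "m \<in> E")
        case False
        obtain s where s: "s \<in> S" "m < s" "\<And>r. r \<in> S \<Longrightarrow> m < r \<Longrightarrow> r \<le> s \<Longrightarrow> F r - F m \<le> \<epsilon> * (r - m)"
          using step[OF mS md False \<epsilon>] by auto
        have "P r" if "r \<in> S" "m < r" "r \<le> s" for r
        proof -
          have "F r \<le> F m + \<epsilon> * (r - m)" using s(3)[OF that] by simp
          also have "\<dots> \<le> F c + \<epsilon> * (m - c) + \<epsilon> * J m + \<epsilon> * (r - m)" using Pm by (simp add: P_def)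
          also have "\<dots> \<le> F c + \<epsilon> * (r - c) + \<epsilon> * J r"
            using J_mono[of m r] \<epsilon> that by (simp add: algebra_simps)
          finally show ?thesis by (simp add: P_def)
        qed
        with s show ?thesis by blast
      next
        case True
        have "en ` UNIV = insert c E"
          unfolding en_def using E by (intro range_from_nat_into) auto
        then obtain n where n: "m = en n" using True by (metis imageE insertI2)
        have "0 < \<epsilon> * (1/2)^n" using \<epsilon> by simp
        then obtain \<delta> where \<delta>: "0 < \<delta>" "\<And>s. s \<in> S \<Longrightarrow> \<bar>s - m\<bar> < \<delta> \<Longrightarrow> \<bar>F s - F m\<bar> \<le> \<epsilon> * (1/2)^n"
          using continuous_within_realD[OF cont] by meson
        obtain s where s: "s \<in> S" "m < s" "s < m + \<delta>"
          using right_dense_approx[OF S(1,4) md E(2)[OF True] \<delta>(1)] by auto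
        have "P r" if "r \<in> S" "m < r" "r \<le> s" for r
        proof -
          have "F r \<le> F m + \<epsilon> * (1/2)^n" using \<delta>(2)[of r] that s by auto
          also have "\<dots> \<le> F c + \<epsilon> * (m - c) + \<epsilon> * (J m + (1/2)^n)"
            using Pm by (simp add: P_def algebra_simps)
          also have "\<dots> \<le> F c + \<epsilon> * (r - c) + \<epsilon> * J r"
            using J_jump[of n r] \<epsilon> that n by (intro add_mono mult_left_mono) auto
          finally show ?thesis by (simp add: P_def)
        qed
        with s show ?thesis by blast
      qed
      then obtain s where s: "s \<in> S" "m < s" "\<forall>r\<in>S. m < r \<and> r \<le> s \<longrightarrow> P r" by auto
      have "s \<in> B"
        using s below Pm by (auto simp: B_def) (metis linorder_less_linear)
      then have "s \<le> m" unfolding m_def using bdd by (intro cSup_upper)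
      with s show False by simp
    qed
    with Pm have "F d \<le> F c + \<epsilon> * (d - c) + \<epsilon> * J d" by (simp add: P_def)
    also have "\<dots> \<le> F c + \<epsilon> * (d - c) + \<epsilon> * 2"
      using J_le[of d] \<epsilon> by simp
    finally show ?thesis .
  qed
  have cd: "c \<le> d" using S by auto
  show ?thesis
  proof (rule field_le_epsilon)
    fix e :: real assume e: "0 < e"
    \<comment> \<open>The divisor is the length \<open>d - c\<close> plus the total allowance 2, the
      sum of the geometric series.\<close>
    have "e / (d - c + 2) * (d - c) + e / (d - c + 2) * 2 = e / (d - c + 2) * (d - c + 2)"
      by (simp only: distrib_left)
    also have "\<dots> = e" using cd by simp
    finally have "e / (d - c + 2) * (d - c) + e / (d - c + 2) * 2 = e" .
    then show "F d \<le> F c + e"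
      using bound[of "e / (d - c + 2)"] e cd by (simp add: add.assoc)
  qed
qed

section \<open>Delta derivatives and integrals\<close>

text \<open>Opens the ordinary differentiation rules to right-dense points, in both
  directions.\<close>

lemma has_delta_derivative_dense_iff:
  assumes "ts_sigma S t = t"
  shows "has_delta_derivative S g D t \<longleftrightarrow> (g has_real_derivative D) (at t within S)"
proof -
  have eq: "\<bar>g t - g s - D * (t - s)\<bar> = \<bar>g s - g t - D * (s - t)\<bar>" for s
    by (simp add: abs_if algebra_simps)
  have "(g has_real_derivative D) (at t within S) \<longleftrightarrow>
      (\<forall>e>0. \<exists>d>0. \<forall>y\<in>S. \<bar>y - t\<bar> < d \<longrightarrow> \<bar>g y - g t - D * (y - t)\<bar> \<le> e * \<bar>y - t\<bar>)"
    unfolding has_field_derivative_def has_derivative_within_alt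
    by (simp add: bounded_linear_mult_right)
  then show ?thesis
    unfolding has_delta_derivative_def assms eq by (simp add: abs_minus_commute)
qed

lemma has_delta_derivative_scatteredD:
  assumes "has_delta_derivative S g D t" "t \<in> S" "t < ts_sigma S t"
  shows "g (ts_sigma S t) - g t = D * (ts_sigma S t - t)"
proof -
  let ?\<mu> = "ts_sigma S t - t"
  have "\<bar>g (ts_sigma S t) - g t - D * ?\<mu>\<bar> \<le> \<epsilon> * ?\<mu>" if "0 < \<epsilon>" for \<epsilon>
    using assms(1)[unfolded has_delta_derivative_def, rule_format, OF that] assms(2,3) by force
  then have "\<bar>g (ts_sigma S t) - g t - D * ?\<mu>\<bar> \<le> 0 + e" if "0 < e" for e
    using that[THEN divide_pos_pos, of ?\<mu>] assms(3) by force
  then have "\<bar>g (ts_sigma S t) - g t - D * ?\<mu>\<bar> \<le> 0"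
    by (rule field_le_epsilon)
  then show ?thesis by simp
qed

lemma has_delta_derivative_scatteredI:
  assumes "continuous (at t within S) g" "t < ts_sigma S t"
    and D: "g (ts_sigma S t) - g t = D * (ts_sigma S t - t)"
  shows "has_delta_derivative S g D t"
  unfolding has_delta_derivative_def
proof (intro allI impI)
  fix \<epsilon> :: real assume \<epsilon>: "0 < \<epsilon>"
  let ?\<mu> = "ts_sigma S t - t"
  have \<mu>: "0 < ?\<mu>" using assms by simp
  \<comment> \<open>The error is \<open>(g t - g s) + D * (s - t)\<close>. Each summand is kept
    below \<eta>, and the total \<open>\<epsilon> * ?\<mu> / 2\<close> is admissible because s stays
    at least \<open>?\<mu> / 2\<close> away from the jump target.\<close>
  define \<eta> where "\<eta> = \<epsilon> * ?\<mu> / 4"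
  have "0 < \<eta>" using \<epsilon> \<mu> by (simp add: \<eta>_def)
  then obtain d where d: "0 < d" "\<And>s. s \<in> S \<Longrightarrow> \<bar>s - t\<bar> < d \<Longrightarrow> \<bar>g s - g t\<bar> \<le> \<eta>"
    using continuous_within_realD[OF assms(1)] by meson
  define \<delta> where "\<delta> = min d (min (?\<mu> / 2) (\<eta> / (\<bar>D\<bar> + 1)))"
  have "0 < \<delta>" using d \<mu> \<open>0 < \<eta>\<close> by (simp add: \<delta>_def)
  moreover have "\<bar>g (ts_sigma S t) - g s - D * (ts_sigma S t - s)\<bar> \<le> \<epsilon> * \<bar>ts_sigma S t - s\<bar>"
    if s: "s \<in> S" "\<bar>s - t\<bar> < \<delta>" for s
  proof -
    have "g (ts_sigma S t) - g s - D * (ts_sigma S t - s) = (g t - g s) + D * (s - t)"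
      using D by (simp add: algebra_simps)
    also have "\<bar>\<dots>\<bar> \<le> \<bar>g s - g t\<bar> + \<bar>D\<bar> * \<bar>s - t\<bar>"
      by (metis abs_minus_commute abs_mult abs_triangle_ineq)
    also have "\<dots> \<le> \<eta> + (\<bar>D\<bar> + 1) * (\<eta> / (\<bar>D\<bar> + 1))"
      using d(2)[OF s(1)] s by (intro add_mono mult_mono) (auto simp: \<delta>_def)
    also have "\<dots> = \<epsilon> * (?\<mu> / 2)" using \<mu> by (simp add: \<eta>_def field_simps add_eq_0_iff)
    also have "\<dots> \<le> \<epsilon> * \<bar>ts_sigma S t - s\<bar>"
      using s \<epsilon> \<mu> by (intro mult_left_mono) (auto simp: \<delta>_def abs_if split: if_splits)
    finally show ?thesis .
  qed
  ultimately show "\<exists>\<delta>>0. \<forall>s\<in>S. \<bar>s - t\<bar> < \<delta> \<longrightarrow>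
      \<bar>g (ts_sigma S t) - g s - D * (ts_sigma S t - s)\<bar> \<le> \<epsilon> * \<bar>ts_sigma S t - s\<bar>"
    by blast
qed

lemma has_delta_derivative_continuous:
  assumes "closed S" "has_delta_derivative S g D t" "t \<in> S"
  shows "continuous (at t within S) g"
proof (cases "ts_sigma S t = t")
  case True
  then show ?thesis
    using assms has_delta_derivative_dense_iff DERIV_continuous by blast
next
  case False
  then have lt: "t < ts_sigma S t" using ts_sigma_ge[OF assms(1), of t] by simp
  let ?\<mu> = "ts_sigma S t - t"
  have eq: "g (ts_sigma S t) = g t + D * ?\<mu>"
    using has_delta_derivative_scatteredD[OF assms(2,3) lt] by simp
  show ?thesis
    unfolding continuous_within_eps_delta dist_real_def
  proof (intro allI impI)
    fix e :: real assume e: "0 < e"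
    \<comment> \<open>Points closer to t than \<open>?\<mu>\<close> have distance at most
      \<open>2 * ?\<mu>\<close> from the jump target, so the derivative estimate costs at most
      \<open>e / 2\<close> and the linear term at most \<open>e / 4\<close>.\<close>
    define \<epsilon> where "\<epsilon> = e / (4 * ?\<mu>)"
    have "0 < \<epsilon>" using e lt by (simp add: \<epsilon>_def)
    then obtain d where d: "0 < d" "\<And>s. s \<in> S \<Longrightarrow> \<bar>s - t\<bar> < d \<Longrightarrow>
        \<bar>g (ts_sigma S t) - g s - D * (ts_sigma S t - s)\<bar> \<le> \<epsilon> * \<bar>ts_sigma S t - s\<bar>"
      using assms(2) unfolding has_delta_derivative_def by meson
    define \<delta> where "\<delta> = min d (min ?\<mu> (e / (4 * (\<bar>D\<bar> + 1))))"
    have "0 < \<delta>" using d lt e by (simp add: \<delta>_def)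
    moreover have "\<bar>g s - g t\<bar> < e" if s: "s \<in> S" "\<bar>s - t\<bar> < \<delta>" for s
    proof -
      have "\<bar>g s - g t\<bar> \<le> \<bar>g (ts_sigma S t) - g s - D * (ts_sigma S t - s)\<bar> + \<bar>D * (s - t)\<bar>"
        unfolding eq by (simp add: algebra_simps abs_if)
      also have "\<dots> \<le> \<epsilon> * \<bar>ts_sigma S t - s\<bar> + \<bar>D\<bar> * \<bar>s - t\<bar>"
        using d(2)[OF s(1)] s by (auto simp: \<delta>_def abs_mult)
      also have "\<dots> \<le> \<epsilon> * (2 * ?\<mu>) + (\<bar>D\<bar> + 1) * (e / (4 * (\<bar>D\<bar> + 1)))"
        using s \<open>0 < \<epsilon>\<close> by (intro add_mono mult_mono) (auto simp: \<delta>_def)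
      also have "\<dots> = e / 2 + e / 4"
      proof -
        have "0 < ?\<mu>" "0 < \<bar>D\<bar> + 1" using lt by auto
        then show ?thesis unfolding \<epsilon>_def by (simp add: divide_simps) (simp add: algebra_simps)
      qed
      finally show ?thesis using e by simp
    qed
    ultimately show "\<exists>\<delta>>0. \<forall>s\<in>S. \<bar>s - t\<bar> < \<delta> \<longrightarrow> \<bar>g s - g t\<bar> < e" by blast
  qed
qed

lemma has_delta_derivative_diff:
  assumes "has_delta_derivative S g D t" "has_delta_derivative S h D' t"
  shows "has_delta_derivative S (\<lambda>x. g x - h x) (D - D') t"
  unfolding has_delta_derivative_def
proof (intro allI impI)
  fix \<epsilon> :: real assume "0 < \<epsilon>"
  then have e: "0 < \<epsilon> / 2" by simp
  obtain d1 where d1: "0 < d1" "\<And>s. s \<in> S \<Longrightarrow> \<bar>s - t\<bar> < d1 \<Longrightarrow>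
      \<bar>g (ts_sigma S t) - g s - D * (ts_sigma S t - s)\<bar> \<le> \<epsilon> / 2 * \<bar>ts_sigma S t - s\<bar>"
    using assms(1) e unfolding has_delta_derivative_def by meson
  obtain d2 where d2: "0 < d2" "\<And>s. s \<in> S \<Longrightarrow> \<bar>s - t\<bar> < d2 \<Longrightarrow>
      \<bar>h (ts_sigma S t) - h s - D' * (ts_sigma S t - s)\<bar> \<le> \<epsilon> / 2 * \<bar>ts_sigma S t - s\<bar>"
    using assms(2) e unfolding has_delta_derivative_def by meson
  have "\<bar>(g (ts_sigma S t) - h (ts_sigma S t)) - (g s - h s) - (D - D') * (ts_sigma S t - s)\<bar>
      \<le> \<epsilon> * \<bar>ts_sigma S t - s\<bar>" if "s \<in> S" "\<bar>s - t\<bar> < min d1 d2" for s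
  proof -
    have eq: "(g (ts_sigma S t) - h (ts_sigma S t)) - (g s - h s) - (D - D') * (ts_sigma S t - s)
      = (g (ts_sigma S t) - g s - D * (ts_sigma S t - s))
        - (h (ts_sigma S t) - h s - D' * (ts_sigma S t - s))" by (simp add: algebra_simps)
    have "\<bar>g (ts_sigma S t) - g s - D * (ts_sigma S t - s)\<bar> \<le> \<epsilon> / 2 * \<bar>ts_sigma S t - s\<bar>"
      "\<bar>h (ts_sigma S t) - h s - D' * (ts_sigma S t - s)\<bar> \<le> \<epsilon> / 2 * \<bar>ts_sigma S t - s\<bar>"
      using d1(2)[of s] d2(2)[of s] that by auto
    then show ?thesis unfolding eq by linarith
  qed
  then show "\<exists>\<delta>>0. \<forall>s\<in>S. \<bar>s - t\<bar> < \<delta> \<longrightarrow>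
      \<bar>(g (ts_sigma S t) - h (ts_sigma S t)) - (g s - h s) - (D - D') * (ts_sigma S t - s)\<bar>
      \<le> \<epsilon> * \<bar>ts_sigma S t - s\<bar>"
    using d1(1) d2(1) by (intro exI[of _ "min d1 d2"]) auto
qed

text \<open>Brings a delta derivative into the form that the monotonicity criterion asks for. At a
  right-scattered point the witness is the jump target: it is the only point in reach, and the
  increment there is exact.\<close>

lemma has_delta_derivative_right_increment:
  assumes "closed S" "has_delta_derivative S g D t" "t \<in> S" "d \<in> S" "t < d" "0 < \<epsilon>"
  shows "\<exists>s\<in>S. t < s \<and> (\<forall>r\<in>S. t < r \<and> r \<le> s \<longrightarrow> \<bar>g r - g t - D * (r - t)\<bar> \<le> \<epsilon> * (r - t))"
proof (cases "ts_sigma S t = t")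
  case True
  obtain \<delta> where \<delta>: "0 < \<delta>" "\<And>s. s \<in> S \<Longrightarrow> \<bar>s - t\<bar> < \<delta> \<Longrightarrow>
      \<bar>g t - g s - D * (t - s)\<bar> \<le> \<epsilon> * \<bar>t - s\<bar>"
    using assms(2,6) True unfolding has_delta_derivative_def by metis
  obtain s where s: "s \<in> S" "t < s" "s < t + \<delta>"
    using right_dense_approx[OF assms(1,4,5) True \<delta>(1)] by auto
  have "\<bar>g r - g t - D * (r - t)\<bar> \<le> \<epsilon> * (r - t)" if "r \<in> S" "t < r" "r \<le> s" for r
    using \<delta>(2)[of r] that s by (auto simp: abs_le_iff algebra_simps)
  with s show ?thesis by blast
next
  case False
  note p = ts_sigma_props[OF assms(1,4,5)]
  have lt: "t < ts_sigma S t" using False p by simp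
  have "\<bar>g r - g t - D * (r - t)\<bar> \<le> \<epsilon> * (r - t)" if "r \<in> S" "t < r" "r \<le> ts_sigma S t" for r
  proof -
    have "r = ts_sigma S t" using p(3)[of r] that by simp
    then show ?thesis
      using has_delta_derivative_scatteredD[OF assms(2,3) lt] lt \<open>0 < \<epsilon>\<close> by simp
  qed
  then show ?thesis using p lt by blast
qed

lemma has_delta_derivative_restrict:
  assumes "closed S" "has_delta_derivative S g D t" "t \<in> S" "s \<in> S" "r \<le> t" "t < s"
  shows "has_delta_derivative (S \<inter> {r..s}) g D t"
  using assms(2) unfolding has_delta_derivative_def ts_sigma_restrict[OF assms(1,3,4,5,6)]
  by (meson IntD1)

section \<open>Antiderivatives and their comparison\<close>

lemma pre_antiderivative_restrict:
  assumes "closed S" "pre_antiderivative S g G" "s \<in> S"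
  shows "pre_antiderivative (S \<inter> {r..s}) g G"
proof -
  obtain E where E: "countable E" "\<forall>t\<in>E. ts_sigma S t = t"
      "\<forall>t \<in> ts_kappa S - E. has_delta_derivative S G (g t) t"
    and cont: "continuous_on S G"
    using assms(2) unfolding pre_antiderivative_def by auto
  \<comment> \<open>The cut makes \<open>s\<close> a maximum, and \<open>s\<close> is declared
    exceptional: its derivative in \<open>S\<close> may be the slope of a jump that leaves the
    truncated scale.\<close>
  define E' where "E' = insert s (E \<inter> S \<inter> {r..<s})"
  have 1: "countable E'"
    using E(1) unfolding E'_def by (metis countable_Int1 countable_insert)
  have 2: "ts_sigma (S \<inter> {r..s}) t = t" if "t \<in> E'" for t
  proof (cases "t = s")
    case True then show ?thesis by (auto intro: ts_sigma_max)
  next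
    case False
    then have "t \<in> E" "t \<in> S" "r \<le> t" "t < s" using that by (auto simp: E'_def)
    then show ?thesis using E(2) ts_sigma_restrict[OF assms(1) \<open>t \<in> S\<close> assms(3)] by simp
  qed
  have 3: "has_delta_derivative (S \<inter> {r..s}) G (g t) t" if t: "t \<in> ts_kappa (S \<inter> {r..s}) - E'" for t
  proof -
    have tS: "t \<in> S" "r \<le> t" "t < s" "t \<notin> E"
      using t ts_kappa_subset[of "S \<inter> {r..s}"] by (force simp: E'_def)+
    then have "t \<in> ts_kappa S - E" using ts_kappa_less assms(3) by auto
    then show ?thesis using E(3) has_delta_derivative_restrict assms tS by simp
  qed
  show ?thesis
    unfolding pre_antiderivative_def
    using cont 1 2 3 by (intro conjI exI[of _ E']) (auto intro: continuous_on_subset)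
qed

text \<open>Used in both directions it shows that the integral is unique; used against linear
  functions it estimates increments.\<close>

lemma pre_antiderivative_mono:
  assumes S: "closed S" "S \<subseteq> {c..d}" "c \<in> S" "d \<in> S"
    and G: "pre_antiderivative S g G" and H: "pre_antiderivative S h H"
    and le: "\<And>t. t \<in> S \<Longrightarrow> t < d \<Longrightarrow> g t \<le> h t"
  shows "G d - G c \<le> H d - H c"
proof -
  obtain E where E: "countable E" "\<forall>t\<in>E. ts_sigma S t = t"
      "\<forall>t \<in> ts_kappa S - E. has_delta_derivative S G (g t) t"
    and cG: "continuous_on S G"
    using G unfolding pre_antiderivative_def by auto
  obtain E' where E': "countable E'" "\<forall>t\<in>E'. ts_sigma S t = t"
      "\<forall>t \<in> ts_kappa S - E'. has_delta_derivative S H (h t) t"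
    and cH: "continuous_on S H"
    using H unfolding pre_antiderivative_def by auto
  have "(\<lambda>x. G x - H x) d \<le> (\<lambda>x. G x - H x) c"
  proof (rule nonincreasing_if_right_increments[OF S, where E = "E \<union> E'"])
    show "continuous_on S (\<lambda>x. G x - H x)" using cG cH by (intro continuous_intros)
    show "countable (E \<union> E')" using E E' by auto
    show "ts_sigma S t = t" if "t \<in> E \<union> E'" for t using that E E' by auto
    fix t \<epsilon> :: real assume t: "t \<in> S" "t < d" "t \<notin> E \<union> E'" and \<epsilon>: "0 < \<epsilon>"
    then have "t \<in> ts_kappa S" using ts_kappa_less S by auto
    then have "has_delta_derivative S (\<lambda>x. G x - H x) (g t - h t) t"
      using t E E' by (intro has_delta_derivative_diff) auto
    from has_delta_derivative_right_increment[OF S(1) this t(1) S(4) t(2) \<epsilon>]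
    obtain s where s: "s \<in> S" "t < s" "\<And>r. r \<in> S \<Longrightarrow> t < r \<Longrightarrow> r \<le> s \<Longrightarrow>
        \<bar>G r - H r - (G t - H t) - (g t - h t) * (r - t)\<bar> \<le> \<epsilon> * (r - t)" by blast
    have "(G r - H r) - (G t - H t) \<le> \<epsilon> * (r - t)" if "r \<in> S" "t < r" "r \<le> s" for r
      using s(3)[OF that] le[OF t(1,2)] that mult_nonpos_nonneg[of "g t - h t" "r - t"] by auto
    with s show "\<exists>s\<in>S. t < s \<and> (\<forall>r\<in>S. t < r \<and> r \<le> s \<longrightarrow>
        (G r - H r) - (G t - H t) \<le> \<epsilon> * (r - t))" by blast
  qed
  then show ?thesis by simp
qed

lemma pre_antiderivative_linear:
  assumes "closed S" shows "pre_antiderivative S (\<lambda>_. C) (\<lambda>x. C * x)"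
proof -
  have "has_delta_derivative S (\<lambda>x. C * x) C t" for t
    unfolding has_delta_derivative_def by (auto simp: algebra_simps intro!: exI[of _ 1])
  then show ?thesis unfolding pre_antiderivative_def
    by (auto intro!: continuous_intros exI[of _ "{}"])
qed

lemma pre_antiderivative_cmult:
  assumes "closed S" "pre_antiderivative S g G"
  shows "pre_antiderivative S (\<lambda>x. C * g x) (\<lambda>x. C * G x)"
proof -
  have *: "has_delta_derivative S (\<lambda>x. C * G x) (C * g t) t"
    if d: "has_delta_derivative S G (g t) t" and t: "t \<in> S" for t
  proof (cases "ts_sigma S t = t")
    case True
    then show ?thesis using d by (auto simp: has_delta_derivative_dense_iff intro: DERIV_cmult)
  next
    case False
    then have lt: "t < ts_sigma S t" using ts_sigma_ge[OF assms(1), of t] by simp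
    show ?thesis
      using has_delta_derivative_scatteredD[OF d t lt, symmetric]
      by (intro has_delta_derivative_scatteredI continuous_intros
        has_delta_derivative_continuous[OF assms(1) d t] lt)
        (simp add: mult.assoc right_diff_distrib[symmetric])
  qed
  show ?thesis
    using assms(2) ts_kappa_subset[of S] * unfolding pre_antiderivative_def
    by (force intro!: continuous_intros)
qed

section \<open>The delta integral and its limits\<close>

lemma delta_integral_eq:
  assumes S: "closed S" "c \<in> S" "d \<in> S" "c \<le> d" and G: "pre_antiderivative (S \<inter> {c..d}) g G"
  shows "delta_integral S c d g = G d - G c"
  unfolding delta_integral_def
proof (rule the_equality)
  show "has_delta_integral S g (G d - G c) c d"
    unfolding has_delta_integral_def using G by blast
  fix I assume "has_delta_integral S g I c d"
  then obtain H where H: "pre_antiderivative (S \<inter> {c..d}) g H" "I = H d - H c"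
    unfolding has_delta_integral_def by blast
  have S': "closed (S \<inter> {c..d})" "S \<inter> {c..d} \<subseteq> {c..d}" "c \<in> S \<inter> {c..d}" "d \<in> S \<inter> {c..d}"
    using S by auto
  show "I = G d - G c"
    using pre_antiderivative_mono[OF S' G H(1)] pre_antiderivative_mono[OF S' H(1) G] H(2) by simp
qed

text \<open>One normalised antiderivative serves all upper limits at once, so the integral can be
  handled as a function of its upper limit.\<close>

lemma delta_integrableE:
  assumes S: "closed S" "c \<in> S" "d \<in> S" "c \<le> d" and i: "delta_integrable S g c d"
  obtains G where "pre_antiderivative (S \<inter> {c..d}) g G" "G c = 0"
    "\<And>t. t \<in> S \<Longrightarrow> c \<le> t \<Longrightarrow> t \<le> d \<Longrightarrow> delta_integral S c t g = G t"
    "\<And>t. t \<in> S \<Longrightarrow> c \<le> t \<Longrightarrow> t \<le> d \<Longrightarrow> pre_antiderivative (S \<inter> {c..t}) g G"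
proof -
  obtain G where G: "pre_antiderivative (S \<inter> {c..d}) g G"
    using i unfolding delta_integrable_def has_delta_integral_def by blast
  have G': "pre_antiderivative (S \<inter> {c..d}) g (\<lambda>x. G x - G c)"
    using G unfolding pre_antiderivative_def has_delta_derivative_def
    by (auto intro!: continuous_intros)
  have R: "pre_antiderivative (S \<inter> {c..t}) g (\<lambda>x. G x - G c)" if "t \<in> S" "c \<le> t" "t \<le> d" for t
  proof -
    have "S \<inter> {c..d} \<inter> {c..t} = S \<inter> {c..t}" using that by auto
    then show ?thesis
      using pre_antiderivative_restrict[OF _ G', of t c] that S by auto
  qed
  show thesis
    using delta_integral_eq[OF S(1,2) _ _ R] by (intro that[OF G' _ _ R]) auto
qed

lemma delta_integral_mono:
  assumes S: "closed S" "c \<in> S" "d \<in> S" "c \<le> d"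
    and i: "delta_integrable S g c d" "delta_integrable S h c d"
    and le: "\<And>t. t \<in> S \<Longrightarrow> c \<le> t \<Longrightarrow> t < d \<Longrightarrow> g t \<le> h t"
  shows "delta_integral S c d g \<le> delta_integral S c d h"
proof -
  obtain G where G: "pre_antiderivative (S \<inter> {c..d}) g G" "G c = 0" "delta_integral S c d g = G d"
    using delta_integrableE[OF S i(1)] S by (metis order_refl)
  obtain H where H: "pre_antiderivative (S \<inter> {c..d}) h H" "H c = 0" "delta_integral S c d h = H d"
    using delta_integrableE[OF S i(2)] S by (metis order_refl)
  show ?thesis
    using pre_antiderivative_mono[OF _ _ _ _ G(1) H(1), of c d] S le G H by auto
qed

lemma delta_integrable_const: "closed S \<Longrightarrow> delta_integrable S (\<lambda>_. C) c d"
  unfolding delta_integrable_def has_delta_integral_def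
  using pre_antiderivative_linear[of "S \<inter> {c..d}" C] by auto

lemma delta_integral_zero:
  assumes "closed S" "c \<in> S" "d \<in> S" "c \<le> d" shows "delta_integral S c d (\<lambda>_. 0) = 0"
  using delta_integral_eq[OF assms pre_antiderivative_linear[of _ 0]] assms by auto

text \<open>In a one-point scale the point is not right-scattered and may itself be exceptional, so
  every integrand is covered, whatever its value at \<open>c\<close>.\<close>

lemma delta_integral_same: "closed S \<Longrightarrow> c \<in> S \<Longrightarrow> delta_integral S c c g = 0"
proof -
  assume S: "closed S" "c \<in> S"
  have "ts_sigma {c} c = c" by (intro ts_sigma_max) auto
  then have "pre_antiderivative {c} g (\<lambda>_. 0)"
    using ts_kappa_subset[of "{c}"]
    unfolding pre_antiderivative_def by (auto intro!: exI[of _ "{c}"])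
  then have "pre_antiderivative (S \<inter> {c..c}) g (\<lambda>_. 0)" using S by simp
  from delta_integral_eq[OF S S(2) order_refl this] show ?thesis by simp
qed

lemma delta_integral_nonneg:
  assumes S: "closed S" "c \<in> S" "d \<in> S" "c \<le> d" and i: "delta_integrable S g c d"
    and le: "\<And>t. t \<in> S \<Longrightarrow> c \<le> t \<Longrightarrow> t < d \<Longrightarrow> 0 \<le> g t"
  shows "0 \<le> delta_integral S c d g"
  using delta_integral_mono[OF S delta_integrable_const[OF S(1)] i, of 0] le
    delta_integral_zero[OF S] by simp

lemma delta_integrable_restrict:
  assumes "closed S" "c \<in> S" "d \<in> S" "t \<in> S" "c \<le> t" "t \<le> d" "delta_integrable S g c d"
  shows "delta_integrable S g c t"
proof -
  obtain G where "pre_antiderivative (S \<inter> {c..t}) g G"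
    using delta_integrableE[of S c d g] assms by (metis order_trans)
  then show ?thesis unfolding delta_integrable_def has_delta_integral_def by blast
qed

lemma delta_integral_cmult:
  assumes S: "closed S" "c \<in> S" "d \<in> S" "c \<le> d" and i: "delta_integrable S g c d"
  shows "delta_integrable S (\<lambda>x. C * g x) c d"
    "delta_integral S c d (\<lambda>x. C * g x) = C * delta_integral S c d g"
proof -
  obtain G where G: "pre_antiderivative (S \<inter> {c..d}) g G"
    using i unfolding delta_integrable_def has_delta_integral_def by blast
  have CG: "pre_antiderivative (S \<inter> {c..d}) (\<lambda>x. C * g x) (\<lambda>x. C * G x)"
    using S by (intro pre_antiderivative_cmult G) auto
  then show "delta_integrable S (\<lambda>x. C * g x) c d"
    unfolding delta_integrable_def has_delta_integral_def by blast
  show "delta_integral S c d (\<lambda>x. C * g x) = C * delta_integral S c d g"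
    using delta_integral_eq[OF S CG] delta_integral_eq[OF S G] by (simp add: right_diff_distrib)
qed

lemma delta_integral_mono_upper:
  assumes S: "closed S" "c \<in> S" "d \<in> S" "t \<in> S" "c \<le> t" "t \<le> d" and i: "delta_integrable S g c d"
    and le: "\<And>t. t \<in> S \<Longrightarrow> c \<le> t \<Longrightarrow> t < d \<Longrightarrow> 0 \<le> g t"
  shows "delta_integral S c t g \<le> delta_integral S c d g"
proof -
  obtain G where G: "pre_antiderivative (S \<inter> {c..d}) g G"
    "delta_integral S c d g = G d" "delta_integral S c t g = G t"
    using delta_integrableE[OF S(1,2,3) order_trans[OF S(5,6)] i] S
    by (metis order_refl order_trans)
  have "pre_antiderivative (S \<inter> {c..d} \<inter> {t..d}) g G"
    using S by (intro pre_antiderivative_restrict[OF _ G(1)]) auto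
  moreover have "S \<inter> {c..d} \<inter> {t..d} = S \<inter> {t..d}" using S by auto
  ultimately have *: "pre_antiderivative (S \<inter> {t..d}) g G" by simp
  have "closed (S \<inter> {t..d})" using S by auto
  from pre_antiderivative_mono[OF this _ _ _ pre_antiderivative_linear[OF this, of 0] *, of t d]
  show ?thesis unfolding G using S le by auto
qed

text \<open>Stands in for the product and chain rules of delta calculus: ordinary derivatives at
  right-dense points, plain algebra with two values at right-scattered ones. Jumps are those of
  \<open>S\<close>; the truncation is dealt with inside.\<close>

lemma nonincreasing_if_derivative_nonpos:
  fixes F :: "real \<Rightarrow> real"
  assumes S: "closed S" "c \<in> S" "d \<in> S" "c \<le> d"
    and F: "continuous_on (S \<inter> {c..d}) F"
    and E: "countable E" "\<And>t. t \<in> E \<Longrightarrow> ts_sigma S t = t"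
    and scattered: "\<And>t. t \<in> S \<Longrightarrow> c \<le> t \<Longrightarrow> t < d \<Longrightarrow> t < ts_sigma S t \<Longrightarrow> F (ts_sigma S t) \<le> F t"
    and dense: "\<And>t. t \<in> S \<Longrightarrow> c \<le> t \<Longrightarrow> t < d \<Longrightarrow> ts_sigma S t = t \<Longrightarrow> t \<notin> E \<Longrightarrow>
      \<exists>D\<le>0. (F has_real_derivative D) (at t within S)"
  shows "F d \<le> F c"
proof (rule nonincreasing_if_right_increments[of "S \<inter> {c..d}" c d F "insert d (E \<inter> (S \<inter> {c..<d}))"])
  show "countable (insert d (E \<inter> (S \<inter> {c..<d})))"
    using E(1) by (metis countable_Int1 countable_insert)
  show "continuous_on (S \<inter> {c..d}) F" by (rule F)
  show "ts_sigma (S \<inter> {c..d}) t = t" if "t \<in> insert d (E \<inter> (S \<inter> {c..<d}))" for t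
  proof (cases "t = d")
    case True then show ?thesis by (auto intro: ts_sigma_max)
  next
    case False
    then have "t \<in> S" "t \<in> E" "c \<le> t" "t < d" using that by auto
    then show ?thesis using ts_sigma_restrict[OF S(1) \<open>t \<in> S\<close> S(3)] E(2) by simp
  qed
  fix t \<epsilon> :: real
  assume t: "t \<in> S \<inter> {c..d}" "t < d" "t \<notin> insert d (E \<inter> (S \<inter> {c..<d}))" and \<epsilon>: "0 < \<epsilon>"
  have tS: "t \<in> S" "c \<le> t" "t \<notin> E" using t by auto
  note p = ts_sigma_props[OF S(1,3) t(2)]
  show "\<exists>s\<in>S \<inter> {c..d}. t < s \<and> (\<forall>r\<in>S \<inter> {c..d}. t < r \<and> r \<le> s \<longrightarrow> F r - F t \<le> \<epsilon> * (r - t))"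
  proof (cases "ts_sigma S t = t")
    case False
    then have lt: "t < ts_sigma S t" using p by simp
    have "F r - F t \<le> \<epsilon> * (r - t)" if "r \<in> S" "t < r" "r \<le> ts_sigma S t" for r
    proof -
      have "r = ts_sigma S t" using p(3)[of r] that by simp
      then have "F r - F t \<le> 0" using scattered[OF tS(1,2) t(2) lt] by simp
      also have "0 \<le> \<epsilon> * (r - t)" using that \<epsilon> by simp
      finally show ?thesis .
    qed
    then show ?thesis using p lt S t p(3)[OF S(3) t(2)]
      by (intro bexI[of _ "ts_sigma S t"]) auto
  next
    case True
    obtain D where D: "D \<le> 0" "(F has_real_derivative D) (at t within S)"
      using dense[OF tS(1,2) t(2) True tS(3)] by auto
    then have "has_delta_derivative S F D t" by (simp add: has_delta_derivative_dense_iff[OF True])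
    from has_delta_derivative_right_increment[OF S(1) this tS(1) S(3) t(2) \<epsilon>]
    obtain s where s: "s \<in> S" "t < s" "\<And>r. r \<in> S \<Longrightarrow> t < r \<Longrightarrow> r \<le> s \<Longrightarrow>
        \<bar>F r - F t - D * (r - t)\<bar> \<le> \<epsilon> * (r - t)" by blast
    have "F r - F t \<le> \<epsilon> * (r - t)" if "r \<in> S" "t < r" "r \<le> s" for r
      using s(3)[OF that] D(1) that mult_nonpos_nonneg[of D "r - t"] by auto
    then show ?thesis using s t S tS by (intro bexI[of _ "min s d"]) (auto simp: min_def)
  qed
qed (use S in auto)

text \<open>Continuity of the integrand at the exceptional points, which are right-dense, removes them.\<close>

lemma pre_antiderivative_rd_continuous:
  assumes S: "closed S" and G: "pre_antiderivative S g G"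
    and rd: "rd_continuous_on S (ts_kappa S) g" and t: "t \<in> ts_kappa S"
  shows "has_delta_derivative S G (g t) t"
proof (cases "ts_sigma S t = t")
  case False
  then show ?thesis using G t unfolding pre_antiderivative_def by blast
next
  case True
  then have cont: "continuous (at t within ts_kappa S) g"
    using rd t unfolding rd_continuous_on_def by auto
  have tS: "t \<in> S" using t ts_kappa_subset by auto
  show ?thesis
    unfolding has_delta_derivative_def True
  proof (intro allI impI)
    fix \<epsilon> :: real assume "0 < \<epsilon>"
    then obtain \<delta> where \<delta>: "0 < \<delta>" "\<And>s. s \<in> ts_kappa S \<Longrightarrow> \<bar>s - t\<bar> < \<delta> \<Longrightarrow> \<bar>g s - g t\<bar> \<le> \<epsilon>"
      using continuous_within_realD[OF cont] by meson
    have bound: "\<bar>G s - G r - g t * (s - r)\<bar> \<le> \<epsilon> * (s - r)"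
      if rs: "r \<in> S" "s \<in> S" "r \<le> s" "\<bar>r - t\<bar> < \<delta>" "\<bar>s - t\<bar> < \<delta>" for r s
    proof -
      have S': "closed (S \<inter> {r..s})" "S \<inter> {r..s} \<subseteq> {r..s}" "r \<in> S \<inter> {r..s}" "s \<in> S \<inter> {r..s}"
        using S rs by auto
      have G': "pre_antiderivative (S \<inter> {r..s}) g G"
        using pre_antiderivative_restrict[OF S G rs(2)] .
      have near: "\<bar>g x - g t\<bar> \<le> \<epsilon>" if "x \<in> S \<inter> {r..s}" "x < s" for x
        using that rs ts_kappa_less[of x S s] by (intro \<delta>(2)) auto
      \<comment> \<open>Near t the integrand lies between \<open>g t - \<epsilon>\<close> and
        \<open>g t + \<epsilon>\<close>, so on every short interval G is squeezed between linear
        functions of these slopes. The bound for arbitrary r and s then serves both sides of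
        t.\<close>
      have "G s - G r \<le> (g t + \<epsilon>) * s - (g t + \<epsilon>) * r"
        using near by (intro pre_antiderivative_mono[OF S' G' pre_antiderivative_linear[OF S'(1)]]) force
      moreover have "(g t - \<epsilon>) * s - (g t - \<epsilon>) * r \<le> G s - G r"
        using near by (intro pre_antiderivative_mono[OF S' pre_antiderivative_linear[OF S'(1)] G']) force
      ultimately show ?thesis by (simp add: abs_le_iff algebra_simps)
    qed
    have "\<bar>G t - G s - g t * (t - s)\<bar> \<le> \<epsilon> * \<bar>t - s\<bar>" if "s \<in> S" "\<bar>s - t\<bar> < \<delta>" for s
    proof (cases "s \<le> t")
      case True
      then show ?thesis using bound[of s t] that tS \<delta>(1) by simp
    next
      case False
      have "\<bar>G t - G s - g t * (t - s)\<bar> = \<bar>G s - G t - g t * (s - t)\<bar>"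
        by (simp add: abs_if algebra_simps)
      then show ?thesis using False bound[of t s] that tS \<delta>(1) by simp
    qed
    then show "\<exists>\<delta>>0. \<forall>s\<in>S. \<bar>s - t\<bar> < \<delta> \<longrightarrow> \<bar>G t - G s - g t * (t - s)\<bar> \<le> \<epsilon> * \<bar>t - s\<bar>"
      using \<delta>(1) by blast
  qed
qed

section \<open>The time scale exponential\<close>

text \<open>With \<open>x\<close> equal to graininess times \<open>f\<close>, this is what the
  cylinder transformation takes off the increment of the antiderivative at a jump.\<close>

definition log_defect :: "real \<Rightarrow> real" where
  "log_defect x = x - ln (1 + x)"

lemma log_defect_nonneg: "0 \<le> x \<Longrightarrow> 0 \<le> log_defect x"
  unfolding log_defect_def using ln_add_one_self_le_self[of x] by simp

lemma log_defect_superadditive: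
  assumes "0 \<le> x" "0 \<le> y" shows "log_defect x + log_defect y \<le> log_defect (x + y)"
proof -
  have "ln (1 + (x + y)) \<le> ln ((1 + x) * (1 + y))"
    using assms by (subst ln_le_cancel_iff) (auto simp: algebra_simps add_pos_nonneg)
  also have "\<dots> = ln (1 + x) + ln (1 + y)" using assms by (intro ln_mult_pos) auto
  finally show ?thesis by (simp add: log_defect_def)
qed

lemma log_defect_mono: "0 \<le> x \<Longrightarrow> x \<le> y \<Longrightarrow> log_defect x \<le> log_defect y"
  using log_defect_superadditive[of x "y - x"] log_defect_nonneg[of "y - x"] by simp

lemma log_defect_le_square: assumes "0 \<le> x" shows "log_defect x \<le> x\<^sup>2"
proof (cases "x \<le> 1")
  case True
  then show ?thesis using ln_one_plus_pos_lower_bound[OF assms] by (simp add: log_defect_def)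
next
  case False
  then have "x \<le> x\<^sup>2" "0 \<le> ln (1 + x)" by (auto simp: power2_eq_square)
  then show ?thesis by (simp add: log_defect_def)
qed

text \<open>\<open>L\<close> is such that \<open>exp (L t - L s)\<close> is the time scale exponential of \<open>f\<close>.\<close>

definition exponent_of :: "real set \<Rightarrow> (real \<Rightarrow> real) \<Rightarrow> (real \<Rightarrow> real) \<Rightarrow> bool" where
  "exponent_of S f L \<longleftrightarrow> continuous_on S L \<and>
     (\<forall>t\<in>ts_kappa S. if ts_sigma S t = t then (L has_real_derivative f t) (at t within S)
        else exp (L (ts_sigma S t)) = exp (L t) * (1 + f t * (ts_sigma S t - t)))"

text \<open>\<open>L\<close> is the antiderivative \<open>F\<close> of \<open>f\<close> corrected at each right-scattered point from the jump
  \<open>x = \<mu> f\<close> to \<open>ln (1 + x)\<close>. Superadditivity of \<open>x - ln (1 + x) \<le> x\<^sup>2\<close> makes the correction over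
  \<open>[s, t)\<close> at most \<open>(F t - F s)\<^sup>2\<close>, so that it does not contribute to derivatives.\<close>

lemma exponent_of_exists:
  fixes f F :: "real \<Rightarrow> real"
  assumes S: "closed S" "S \<subseteq> {a..b}" "a \<in> S"
    and contF: "continuous_on S F"
    and monoF: "\<And>s t. s \<in> S \<Longrightarrow> t \<in> S \<Longrightarrow> s \<le> t \<Longrightarrow> F s \<le> F t"
    and dF: "\<And>t. t \<in> ts_kappa S \<Longrightarrow> has_delta_derivative S F (f t) t"
  shows "\<exists>L. exponent_of S f L"
proof -
  define R where "R = {r \<in> S. r < ts_sigma S r}"
  define x where "x r = F (ts_sigma S r) - F r" for r
  define M where "M t = (\<Sum>\<^sub>\<infinity>r\<in>{r\<in>R. r < t}. log_defect (x r))" for t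
  have sR: "ts_sigma S r \<in> S" "ts_sigma S r \<le> t" if "r \<in> R" "t \<in> S" "r < t" for r t
    using ts_sigma_props[OF S(1) that(2,3)] that by auto
  \<comment> \<open>The intervals from r to its jump target do not overlap. Removing the last jump
    \<open>m\<close> leaves jumps within \<open>[s, m]\<close>, and superadditivity joins its
    contribution to theirs.\<close>
  have fin: "(\<Sum>r\<in>A. log_defect (x r)) \<le> log_defect (F t - F s)"
    if "finite A" "A \<subseteq> {r\<in>R. s \<le> r \<and> r < t}" "s \<in> S" "t \<in> S" "s \<le> t" for A s t
    using that
  proof (induction A arbitrary: t rule: finite_linorder_max_induct)
    case empty
    then show ?case using monoF by (simp add: log_defect_nonneg)
  next
    case (insert m A)
    have m: "m \<in> R" "s \<le> m" "m < t" "m \<in> S" using insert.prems by (auto simp: R_def)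
    note \<sigma> = sR[OF m(1) insert.prems(3) m(3)]
    have mlt: "m < ts_sigma S m" using m by (simp add: R_def)
    have "(\<Sum>r\<in>insert m A. log_defect (x r)) = log_defect (x m) + (\<Sum>r\<in>A. log_defect (x r))"
      using insert.hyps by (subst sum.insert) auto
    also have "\<dots> \<le> log_defect (x m) + log_defect (F m - F s)"
      using insert.prems insert.hyps m by (intro add_left_mono insert.IH) auto
    also have "\<dots> \<le> log_defect (x m + (F m - F s))"
      using m \<sigma> mlt insert.prems by (intro log_defect_superadditive) (auto simp: x_def intro!: monoF)
    also have "\<dots> \<le> log_defect (F t - F s)"
      using m \<sigma> mlt insert.prems monoF[OF m(4) \<sigma>(1)] monoF[OF \<sigma>(1) _ \<sigma>(2)] monoF[OF insert.prems(2) m(4)]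
      by (intro log_defect_mono) (auto simp: x_def)
    finally show ?case .
  qed
  have xnn: "0 \<le> log_defect (x r)" if "r \<in> R" "r < t" "t \<in> S" for r t
    using that sR[OF that(1,3,2)]
    by (intro log_defect_nonneg) (auto simp: x_def R_def intro!: monoF)
  have sm: "(\<lambda>r. log_defect (x r)) summable_on {r\<in>R. s \<le> r \<and> r < t}" if "s \<in> S" "t \<in> S" "s \<le> t" for s t
  proof (rule nonneg_bdd_above_summable_on)
    show "bdd_above (sum (\<lambda>r. log_defect (x r)) ` {F. F \<subseteq> {r \<in> R. s \<le> r \<and> r < t} \<and> finite F})"
      using fin that by (intro bdd_aboveI[of _ "log_defect (F t - F s)"]) auto
  qed (use xnn that in auto)
  have a_min: "{r\<in>R. r < t} = {r\<in>R. a \<le> r \<and> r < t}" for t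
    using S(2) by (auto simp: R_def)
  have M_diff: "M t - M s = (\<Sum>\<^sub>\<infinity>r\<in>{r\<in>R. s \<le> r \<and> r < t}. log_defect (x r))"
    if st: "s \<in> S" "t \<in> S" "s \<le> t" for s t
  proof -
    have as: "a \<le> s" using st S by auto
    have "{r\<in>R. r < t} = {r\<in>R. r < s} \<union> {r\<in>R. s \<le> r \<and> r < t}"
      using st by auto
    moreover have "infsum (\<lambda>r. log_defect (x r)) ({r\<in>R. r < s} \<union> {r\<in>R. s \<le> r \<and> r < t})
        = M s + (\<Sum>\<^sub>\<infinity>r\<in>{r\<in>R. s \<le> r \<and> r < t}. log_defect (x r))"
      unfolding M_def
      using sm[of a s] sm[OF st] st as S(3) by (intro infsum_Un_disjoint) (auto simp: a_min)
    ultimately show ?thesis by (simp add: M_def)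
  qed
  have M_bounds: "0 \<le> M t - M s" "M t - M s \<le> log_defect (F t - F s)"
    if st: "s \<in> S" "t \<in> S" "s \<le> t" for s t
    unfolding M_diff[OF st] using xnn fin st
    by (auto intro!: infsum_nonneg infsum_le_finite_sums[OF sm])
  have M_sq: "\<bar>M s - M t\<bar> \<le> (F s - F t)\<^sup>2" if st: "s \<in> S" "t \<in> S" for s t
  proof (cases "s \<le> t")
    case True
    then show ?thesis
      using M_bounds[OF st True] log_defect_le_square[of "F t - F s"] monoF[OF st True]
      by (simp add: power2_commute)
  next
    case False
    then show ?thesis
      using M_bounds[OF st(2,1)] log_defect_le_square[of "F s - F t"] monoF[OF st(2,1)] by simp
  qed
  have M_lip: "\<bar>M s - M t\<bar> \<le> \<bar>F s - F t\<bar>" if st: "s \<in> S" "t \<in> S" for s t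
  proof -
    have ld: "log_defect y \<le> y" if "0 \<le> y" for y
      using that by (simp add: log_defect_def)
    show ?thesis
    proof (cases "s \<le> t")
      case True
      then show ?thesis
        using M_bounds[OF st True] ld[of "F t - F s"] monoF[OF st True] by simp
    next
      case False
      then show ?thesis
        using M_bounds[OF st(2,1)] ld[of "F s - F t"] monoF[OF st(2,1)] by simp
    qed
  qed
  have contM: "continuous_on S M"
    unfolding continuous_on_iff dist_real_def
  proof (intro ballI allI impI)
    fix t e :: real assume "t \<in> S" "0 < e"
    then obtain d where "0 < d" "\<forall>s\<in>S. \<bar>s - t\<bar> < d \<longrightarrow> \<bar>F s - F t\<bar> < e"
      using contF unfolding continuous_on_iff dist_real_def by meson
    then show "\<exists>d>0. \<forall>s\<in>S. \<bar>s - t\<bar> < d \<longrightarrow> \<bar>M s - M t\<bar> < e"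
      using M_lip \<open>t \<in> S\<close> by (meson le_less_trans)
  qed
  define L where "L t = F t - M t" for t
  have "exponent_of S f L"
    unfolding exponent_of_def
  proof (intro conjI ballI)
    show "continuous_on S L"
      unfolding L_def using contF contM by (intro continuous_intros)
    fix t assume t: "t \<in> ts_kappa S"
    have tS: "t \<in> S" using t ts_kappa_subset by auto
    have "(L has_real_derivative f t) (at t within S)" if eq: "ts_sigma S t = t"
    proof -
      have F': "(F has_real_derivative f t) (at t within S)"
        using dF[OF t] has_delta_derivative_dense_iff[OF eq] by simp
      have N: "((\<lambda>s. (F s - F t)\<^sup>2) has_real_derivative 0) (at t within S)"
        by (rule derivative_eq_intros F' refl | simp)+
      then have "has_delta_derivative S (\<lambda>s. (F s - F t)\<^sup>2) 0 t"
        by (simp add: has_delta_derivative_dense_iff[OF eq])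
      then have "has_delta_derivative S M 0 t"
        unfolding has_delta_derivative_def eq using M_sq[OF tS] 
        by (simp add: power2_commute[of "F t"]) (meson order_trans)
      then have "(M has_real_derivative 0) (at t within S)"
        by (simp add: has_delta_derivative_dense_iff[OF eq])
      from DERIV_diff[OF F' this] show ?thesis unfolding L_def by simp
    qed
    moreover have "exp (L (ts_sigma S t)) = exp (L t) * (1 + f t * (ts_sigma S t - t))"
      if "ts_sigma S t \<noteq> t"
    proof -
      have lt: "t < ts_sigma S t" using that ts_sigma_ge[OF S(1), of t] by simp
      then obtain r where r: "r \<in> S" "t < r" using ts_sigma_max[of S t] by force
      note p = ts_sigma_props[OF S(1) r]
      have tR: "t \<in> R" using tS lt by (simp add: R_def)
      have "{r\<in>R. t \<le> r \<and> r < ts_sigma S t} = {t}"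
        using tR lt p(3) by (force simp: R_def)
      then have "M (ts_sigma S t) - M t = log_defect (x t)"
        using M_diff[OF tS p(1)] lt by simp
      then have "L (ts_sigma S t) = L t + ln (1 + x t)"
        by (simp add: L_def log_defect_def x_def)
      moreover have "0 \<le> x t" using monoF[OF tS p(1)] lt by (simp add: x_def)
      moreover have "x t = f t * (ts_sigma S t - t)"
        unfolding x_def by (rule has_delta_derivative_scatteredD[OF dF[OF t] tS lt])
      ultimately show ?thesis by (simp add: exp_add)
    qed
    ultimately show "if ts_sigma S t = t then (L has_real_derivative f t) (at t within S)
        else exp (L (ts_sigma S t)) = exp (L t) * (1 + f t * (ts_sigma S t - t))" by simp
  qed
  then show ?thesis by blast
qed

text \<open>An exponent forces \<open>f\<close> to be positively regressive, because the factor is a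
  quotient of two exponentials.\<close>

lemma exponent_of_scattered:
  assumes "exponent_of S f L" "t \<in> ts_kappa S" "t < ts_sigma S t"
  shows "exp (L (ts_sigma S t)) = exp (L t) * (1 + f t * (ts_sigma S t - t))"
    "0 < 1 + f t * (ts_sigma S t - t)"
proof -
  show *: "exp (L (ts_sigma S t)) = exp (L t) * (1 + f t * (ts_sigma S t - t))"
    using assms unfolding exponent_of_def by (metis less_irrefl)
  have "0 < exp (L t) * (1 + f t * (ts_sigma S t - t))"
    unfolding *[symmetric] by simp
  then show "0 < 1 + f t * (ts_sigma S t - t)" by (simp add: zero_less_mult_iff)
qed

lemma exponent_of_dense:
  assumes "exponent_of S f L" "t \<in> ts_kappa S" "ts_sigma S t = t"
  shows "(L has_real_derivative f t) (at t within S)"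
  using assms unfolding exponent_of_def by metis

text \<open>Uniqueness comes from dividing an arbitrary solution by \<open>exp (L x)\<close>: the
  quotient is unchanged by jumps and has derivative zero at right-dense points. It is constant on
  all of \<open>S\<close>, which also covers \<open>t < s\<close>.\<close>

lemma ts_exp_eq:
  assumes S: "closed S" and L: "exponent_of S f L" and "s \<in> S" "t \<in> S"
  shows "ts_exp S f t s = exp (L t - L s)"
  unfolding ts_exp_def
proof (rule the_equality)
  have contL: "continuous_on S L" using L by (simp add: exponent_of_def)
  have "has_delta_derivative S (\<lambda>x. exp (L x - L s)) (f x * exp (L x - L s)) x"
    if x: "x \<in> ts_kappa S" for x
  proof (cases "ts_sigma S x = x")
    case True
    show ?thesis
      unfolding has_delta_derivative_dense_iff[OF True]
      by (rule derivative_eq_intros exponent_of_dense[OF L x True] refl | simp)+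
  next
    case False
    then have lt: "x < ts_sigma S x" using ts_sigma_ge[OF S, of x] by simp
    show ?thesis
      using contL x ts_kappa_subset[of S]
      by (intro has_delta_derivative_scatteredI lt continuous_intros)
        (auto simp: continuous_on_eq_continuous_within exp_diff exponent_of_scattered[OF L x lt] field_simps)
  qed
  then show "\<exists>y. (\<forall>x\<in>ts_kappa S. has_delta_derivative S y (f x * y x) x) \<and> y s = 1 \<and>
      exp (L t - L s) = y t"
    by (intro exI[of _ "\<lambda>x. exp (L x - L s)"]) simp
  fix v assume "\<exists>y. (\<forall>x\<in>ts_kappa S. has_delta_derivative S y (f x * y x) x) \<and> y s = 1 \<and> v = y t"
  then obtain y where y: "\<And>x. x \<in> ts_kappa S \<Longrightarrow> has_delta_derivative S y (f x * y x) x" "y s = 1" "v = y t"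
    by auto
  \<comment> \<open>The equation yields continuity on \<open>ts_kappa S\<close>. The only other
    point possible is a left-scattered maximum, which is isolated.\<close>
  have conty: "continuous (at x within S) y" if "x \<in> S" for x
  proof (cases "x \<in> ts_kappa S")
    case True
    then show ?thesis using has_delta_derivative_continuous[OF S y(1)] that by simp
  next
    case False
    then have *: "\<forall>s\<in>S. s \<le> x" "ts_rho S x < x" using that by (auto simp: ts_kappa_def)
    then have "ts_rho S x = Sup {s\<in>S. s < x}" by (auto simp: ts_rho_def split: if_splits)
    moreover have "bdd_above {s\<in>S. s < x}" by (auto intro: bdd_aboveI[of _ x])
    ultimately have "s \<le> ts_rho S x" if "s \<in> S" "s \<noteq> x" for s
      using *(1) that by (force intro!: cSup_upper)
    then have "S \<inter> {ts_rho S x<..} \<subseteq> {x}" by force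
    then have "\<not> x islimpt S"
      using *(2) islimpt_def[of x S] by (metis IntI greaterThan_iff open_greaterThan singletonD subset_iff)
    then have "at x within S = bot" by (simp add: trivial_limit_within)
    then show ?thesis by simp
  qed
  define q where "q x = y x * exp (- L x)" for x
  have contq: "continuous_on S q"
    unfolding q_def continuous_on_eq_continuous_within using conty contL
    by (auto intro!: continuous_intros simp: continuous_on_eq_continuous_within)
  have q_scat: "q (ts_sigma S x) = q x" if "x \<in> ts_kappa S" "x < ts_sigma S x" for x
  proof -
    have "x \<in> S" using that ts_kappa_subset by auto
    from has_delta_derivative_scatteredD[OF y(1)[OF that(1)] this that(2)]
    have eq: "y (ts_sigma S x) = y x * (1 + f x * (ts_sigma S x - x))" by (simp add: algebra_simps)
    show ?thesis
      using exponent_of_scattered[OF L that] unfolding q_def eq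
      by (simp add: exp_minus)
  qed
  have q_dense: "(q has_real_derivative 0) (at x within S)"
    if x: "x \<in> ts_kappa S" "ts_sigma S x = x" for x
  proof -
    have y': "(y has_real_derivative f x * y x) (at x within S)"
      using y(1)[OF x(1)] by (simp add: has_delta_derivative_dense_iff[OF x(2)])
    show ?thesis
      unfolding q_def
      by (rule derivative_eq_intros y' exponent_of_dense[OF L x] refl | simp)+
  qed
  have q_const: "q d = q c" if cd: "c \<in> S" "d \<in> S" "c \<le> d" for c d
  proof -
    have \<kappa>: "x \<in> ts_kappa S" if "x \<in> S" "x < d" for x
      using that cd ts_kappa_less by auto
    have "q d \<le> q c"
      using \<kappa> q_scat q_dense
      by (intro nonincreasing_if_derivative_nonpos[OF S cd, of q "{}"] continuous_on_subset[OF contq]) auto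
    moreover have "- q d \<le> - q c"
    proof (rule nonincreasing_if_derivative_nonpos[OF S cd, of "\<lambda>x. - q x" "{}"])
      show "\<exists>D\<le>0. ((\<lambda>x. - q x) has_real_derivative D) (at x within S)"
        if "x \<in> S" "x < d" "ts_sigma S x = x" for x
        using DERIV_minus[OF q_dense[OF \<kappa>]] that by force
    qed (use \<kappa> q_scat in \<open>auto intro!: continuous_on_minus continuous_on_subset[OF contq]\<close>)
    ultimately show ?thesis by simp
  qed
  have "q t = q s"
    using q_const[of s t] q_const[of t s] assms(3,4) by (cases "s \<le> t") auto
  then show "v = exp (L t - L s)"
    using y by (simp add: q_def exp_minus exp_diff field_simps)
qed

text \<open>As a function of s, \<open>- exp (L t - L s)\<close> is an antiderivative: the factor
  \<open>1 + f s * (ts_sigma S s - s)\<close> carries the exponential started at the jump target to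
  the one started at s. This is what turns \<open>p\<close> into an exponential.\<close>

lemma delta_integral_ts_exp:
  assumes S: "closed S" and L: "exponent_of S f L" and at: "a \<in> S" "t \<in> S" "a \<le> t"
  shows "delta_integral S a t (\<lambda>s. f s * ts_exp S f t (ts_sigma S s)) = exp (L t - L a) - 1"
proof -
  define G where "G s = - exp (L t - L s)" for s
  have contL: "continuous_on S L" using L by (simp add: exponent_of_def)
  have contG: "continuous_on S G" unfolding G_def using contL by (intro continuous_intros)
  have d: "has_delta_derivative S G (f s * ts_exp S f t (ts_sigma S s)) s" if s: "s \<in> S" "s < t" for s
  proof -
    have s\<kappa>: "s \<in> ts_kappa S" using s at ts_kappa_less by auto
    have \<sigma>: "ts_sigma S s \<in> S" using ts_sigma_props(1)[OF S at(2) s(2)] .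
    note e = ts_exp_eq[OF S L \<sigma> at(2)]
    show ?thesis
    proof (cases "ts_sigma S s = s")
      case True
      have "ts_exp S f t s = exp (L t - L s)" using e True by simp
      then show ?thesis
        unfolding has_delta_derivative_dense_iff[OF True] True G_def
        by - (rule derivative_eq_intros exponent_of_dense[OF L s\<kappa> True] refl | simp)+
    next
      case False
      then have lt: "s < ts_sigma S s" using ts_sigma_ge[OF S, of s] by simp
      let ?m = "1 + f s * (ts_sigma S s - s)"
      have m: "0 < ?m" "exp (L (ts_sigma S s)) = exp (L s) * ?m"
        using exponent_of_scattered[OF L s\<kappa> lt] by auto
      have 1: "exp (L t - L s) = ?m * exp (L t - L (ts_sigma S s))"
        using m by (simp add: exp_diff)
      have "G (ts_sigma S s) - G s = f s * ts_exp S f t (ts_sigma S s) * (ts_sigma S s - s)"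
        unfolding e G_def 1 by (simp add: algebra_simps)
      then show ?thesis
        using contG s by (intro has_delta_derivative_scatteredI lt)
          (auto simp: continuous_on_eq_continuous_within)
    qed
  qed
  have "has_delta_derivative (S \<inter> {a..t}) G (f s * ts_exp S f t (ts_sigma S s)) s"
    if "s \<in> ts_kappa (S \<inter> {a..t}) - {t}" for s
  proof -
    have "s \<in> S" "a \<le> s" "s < t"
      using that ts_kappa_subset[of "S \<inter> {a..t}"] by force+
    then show ?thesis using d by (intro has_delta_derivative_restrict S at) auto
  qed
  moreover have "ts_sigma (S \<inter> {a..t}) t = t" by (auto intro: ts_sigma_max)
  moreover have "continuous_on (S \<inter> {a..t}) G" using contG by (rule continuous_on_subset) auto
  ultimately have "pre_antiderivative (S \<inter> {a..t}) (\<lambda>s. f s * ts_exp S f t (ts_sigma S s)) G"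
    unfolding pre_antiderivative_def by (intro conjI exI[of _ "{t}"]) auto
  from delta_integral_eq[OF S at this] show ?thesis by (simp add: G_def)
qed

text \<open>\<open>exp (- L t)\<close> is an integrating factor for \<open>N + U t\<close>: a jump
  multiplies \<open>N + U t\<close> by at most the same factor by which it multiplies
  \<open>exp (L t)\<close>.\<close>

lemma delta_gronwall:
  assumes S: "closed S" and L: "exponent_of S f L" and cd: "c \<in> S" "d \<in> S" "c \<le> d"
    and f: "\<And>t. t \<in> S \<Longrightarrow> t < d \<Longrightarrow> 0 \<le> f t"
    and U: "pre_antiderivative (S \<inter> {c..d}) (\<lambda>s. f s * u s) U" "U c = 0"
    and le: "\<And>t. t \<in> S \<Longrightarrow> c \<le> t \<Longrightarrow> t < d \<Longrightarrow> u t \<le> N + U t"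
  shows "N + U d \<le> N * exp (L d - L c)"
proof -
  let ?S = "S \<inter> {c..d}"
  obtain E where E: "countable E" "\<forall>t\<in>E. ts_sigma ?S t = t"
      "\<forall>t \<in> ts_kappa ?S - E. has_delta_derivative ?S U (f t * u t) t"
    and contU: "continuous_on ?S U"
    using U unfolding pre_antiderivative_def by auto
  define Q where "Q t = (N + U t) * exp (- L t)" for t
  have contL: "continuous_on ?S L"
    using L by (auto simp: exponent_of_def intro: continuous_on_subset)
  have "Q d \<le> Q c"
  proof (rule nonincreasing_if_derivative_nonpos[where S = ?S and E = E and c = c and d = d and F = Q])
    have "continuous_on ?S Q"
      unfolding Q_def using contU contL by (intro continuous_intros)
    then show "continuous_on (?S \<inter> {c..d}) Q" by (rule continuous_on_subset) auto
    fix t assume t: "t \<in> ?S" "t < d"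
    have tS: "t \<in> S" "c \<le> t" and \<kappa>: "t \<in> ts_kappa S" "t \<in> ts_kappa ?S"
      using t cd ts_kappa_less[of t _ d] by auto
    have \<sigma>: "ts_sigma ?S t = ts_sigma S t"
      using t cd by (intro ts_sigma_restrict S) auto
    have ge: "f t * u t \<le> f t * (N + U t)"
      using f le t tS by (intro mult_left_mono) auto
    show "Q (ts_sigma ?S t) \<le> Q t" if lt: "t < ts_sigma ?S t"
    proof -
      have "t \<notin> E" using E(2) lt by auto
      then have dU: "has_delta_derivative ?S U (f t * u t) t" using E(3) \<kappa> by auto
      let ?\<mu> = "ts_sigma S t - t"
      have "U (ts_sigma S t) = U t + f t * u t * ?\<mu>"
        using has_delta_derivative_scatteredD[OF dU t(1) lt] \<sigma> by simp
      also have "\<dots> \<le> U t + f t * (N + U t) * ?\<mu>"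
        using ge lt \<sigma> by (intro add_left_mono mult_right_mono) auto
      finally have *: "N + U (ts_sigma S t) \<le> (N + U t) * (1 + f t * ?\<mu>)"
        by (simp add: algebra_simps)
      have m: "0 < 1 + f t * ?\<mu>" "exp (L (ts_sigma S t)) = exp (L t) * (1 + f t * ?\<mu>)"
        using exponent_of_scattered[OF L \<kappa>(1)] lt \<sigma> by auto
      have "Q (ts_sigma S t) \<le> (N + U t) * (1 + f t * ?\<mu>) * exp (- L (ts_sigma S t))"
        unfolding Q_def using * by (intro mult_right_mono) auto
      also have "\<dots> = Q t"
        using m by (simp add: Q_def exp_minus)
      finally show ?thesis by (simp add: \<sigma>)
    qed
    show "\<exists>D\<le>0. (Q has_real_derivative D) (at t within ?S)" if eq: "ts_sigma ?S t = t" and "t \<notin> E"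
    proof -
      have U': "(U has_real_derivative f t * u t) (at t within ?S)"
        using E(3) \<kappa> \<open>t \<notin> E\<close> by (simp flip: has_delta_derivative_dense_iff[OF eq])
      have L': "(L has_real_derivative f t) (at t within ?S)"
        using exponent_of_dense[OF L \<kappa>(1)] eq \<sigma> by (auto intro: has_field_derivative_subset)
      have "(Q has_real_derivative (f t * u t - f t * (N + U t)) * exp (- L t)) (at t within ?S)"
        unfolding Q_def by (rule derivative_eq_intros U' L' refl | simp add: algebra_simps)+
      moreover have "(f t * u t - f t * (N + U t)) * exp (- L t) \<le> 0"
        using ge by (intro mult_nonpos_nonneg) auto
      ultimately show ?thesis by blast
    qed
  qed (use S cd E in auto)
  then show ?thesis
    using U(2) by (simp add: Q_def exp_minus exp_diff field_simps)
qed

section \<open>Kernels and the nonlinear comparison\<close>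

lemma ts_rho_props:
  assumes "closed S" "s \<in> S" "s < t"
  shows "ts_rho S t \<in> S" "ts_rho S t \<le> t" "\<And>r. r \<in> S \<Longrightarrow> r < t \<Longrightarrow> r \<le> ts_rho S t"
proof -
  let ?R = "{s \<in> S. s < t}"
  have ne: "?R \<noteq> {}" and bdd: "bdd_above ?R"
    using assms by (auto intro: bdd_aboveI[of _ t])
  have eq: "ts_rho S t = Sup ?R"
    using assms unfolding ts_rho_def by auto
  have "Sup ?R \<in> closure ?R"
    by (rule closure_contains_Sup[OF ne bdd])
  also have "\<dots> \<subseteq> S"
    using \<open>closed S\<close> by (intro closure_minimal) auto
  finally show "ts_rho S t \<in> S"
    by (simp add: eq)
  show "ts_rho S t \<le> t"
    unfolding eq using ne by (intro cSup_least) auto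
  show "r \<le> ts_rho S t" if "r \<in> S" "r < t" for r
    unfolding eq using that bdd by (intro cSup_upper) auto
qed

text \<open>The uniform estimate in the definition of admissibility makes \<open>kdelta\<close> a
  genuine delta derivative of the section at \<tau>, and \<tau> \<le> s keeps its sign known on
  \<open>[s, t]\<close>. Admissibility speaks only of points beyond \<open>a\<close>, hence
  \<open>a < s\<close>; with \<open>t \<in> ts_kappa S\<close> it still gives continuity at the
  right end.\<close>

lemma admissible_kernel_mono:
  assumes S: "closed S" and k: "admissible_kernel S a k"
    and nonneg: "\<forall>t \<in> ts_kappa S. \<forall>s \<in> ts_kappa S.
          s \<le> t \<and> delta_differentiable S (\<lambda>x. k x s) t \<longrightarrow> 0 \<le> kdelta S k t s"
    and "s \<in> S" "t \<in> ts_kappa S" "s \<le> t" "a < s" and \<tau>: "\<tau> \<in> ts_kappa S" "a \<le> \<tau>" "\<tau> \<le> s"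
  shows "k s \<tau> \<le> k t \<tau>"
proof -
  have tS: "t \<in> S" using assms ts_kappa_subset by auto
  have d: "has_delta_derivative S (\<lambda>x. k x \<tau>) (kdelta S k x \<tau>) x" "0 \<le> kdelta S k x \<tau>"
    and x\<kappa>: "x \<in> S" if x: "x \<in> S" "s \<le> x" "x \<le> t" for x
  proof -
    show "x \<in> S" by fact
    have "x \<in> ts_kappa S"
      using x assms(5) tS ts_kappa_less[of x S t] by (cases "x = t") auto
    moreover have "\<tau> \<in> ts_kappa S \<inter> {a..ts_sigma S x}"
      using \<tau> x ts_sigma_ge[OF S, of x] by auto
    ultimately show d: "has_delta_derivative S (\<lambda>x. k x \<tau>) (kdelta S k x \<tau>) x"
      using k x \<open>a < s\<close> unfolding admissible_kernel_def has_delta_derivative_def by (meson less_le_trans)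
    then show "0 \<le> kdelta S k x \<tau>"
      using nonneg \<open>x \<in> ts_kappa S\<close> x \<tau> unfolding delta_differentiable_def by (meson order_trans)
  qed
  have "- k t \<tau> \<le> - k s \<tau>"
  proof (rule nonincreasing_if_derivative_nonpos[OF S \<open>s \<in> S\<close> tS \<open>s \<le> t\<close>, of "\<lambda>x. - k x \<tau>" "{}"])
    have "continuous (at x within S \<inter> {s..t}) (\<lambda>x. k x \<tau>)" if "x \<in> S \<inter> {s..t}" for x
      using that by (intro continuous_within_subset[OF has_delta_derivative_continuous[OF S d(1)]]) auto
    then show "continuous_on (S \<inter> {s..t}) (\<lambda>x. - k x \<tau>)"
      by (intro continuous_on_minus) (auto simp: continuous_on_eq_continuous_within)
    fix x assume x: "x \<in> S" "s \<le> x" "x < t"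
    then have x': "x \<le> t" by simp
    show "- k (ts_sigma S x) \<tau> \<le> - k x \<tau>" if lt: "x < ts_sigma S x"
    proof -
      have "0 \<le> kdelta S k x \<tau> * (ts_sigma S x - x)"
        using d(2)[OF x(1,2) x'] lt by simp
      then show ?thesis
        using has_delta_derivative_scatteredD[OF d(1)[OF x(1,2) x'] x(1) lt] by simp
    qed
    show "\<exists>D\<le>0. ((\<lambda>x. - k x \<tau>) has_real_derivative D) (at x within S)" if "ts_sigma S x = x"
      using d[OF x(1,2) x'] has_delta_derivative_dense_iff[OF that]
      by (intro exI[of _ "- kdelta S k x \<tau>"]) (auto intro!: DERIV_minus)
  qed auto
  then show ?thesis by simp
qed

text \<open>Nothing is known about \<open>k\<close> at \<open>(a, a)\<close>, but the integral up to \<open>a\<close> vanishes.\<close>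

lemma kernel_integral_mono:
  assumes S: "closed S" "a \<in> S" and k: "admissible_kernel S a k"
    and k_nonneg: "\<forall>t\<in>S. \<forall>s \<in> ts_kappa S. s \<le> t \<longrightarrow> 0 \<le> k t s"
    and nonneg: "\<forall>t \<in> ts_kappa S. \<forall>s \<in> ts_kappa S.
          s \<le> t \<and> delta_differentiable S (\<lambda>x. k x s) t \<longrightarrow> 0 \<le> kdelta S k t s"
    and q: "\<And>\<tau>. \<tau> \<in> ts_kappa S \<Longrightarrow> 0 \<le> q \<tau>"
    and i: "\<And>t. t \<in> ts_kappa S \<Longrightarrow> delta_integrable S (\<lambda>\<tau>. k t \<tau> * q \<tau>) a t"
    and st: "s \<in> S" "t \<in> ts_kappa S" "a \<le> s" "s \<le> t"
  shows "delta_integral S a s (\<lambda>\<tau>. k s \<tau> * q \<tau>) \<le> delta_integral S a s (\<lambda>\<tau>. k t \<tau> * q \<tau>)"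
    "delta_integral S a s (\<lambda>\<tau>. k t \<tau> * q \<tau>) \<le> delta_integral S a t (\<lambda>\<tau>. k t \<tau> * q \<tau>)"
    "0 \<le> delta_integral S a t (\<lambda>\<tau>. k t \<tau> * q \<tau>)"
proof -
  have tS: "t \<in> S" using st ts_kappa_subset by auto
  have s\<kappa>: "s \<in> ts_kappa S" using st tS ts_kappa_less[of s S t] by (cases "s = t") auto
  have \<kappa>: "\<tau> \<in> ts_kappa S" if "\<tau> \<in> S" "\<tau> < t" for \<tau>
    using that ts_kappa_less tS by auto
  have nn: "0 \<le> k t \<tau> * q \<tau>" if "\<tau> \<in> S" "\<tau> < t" for \<tau>
    using that \<kappa>[OF that] q k_nonneg tS by auto
  show "delta_integral S a s (\<lambda>\<tau>. k t \<tau> * q \<tau>) \<le> delta_integral S a t (\<lambda>\<tau>. k t \<tau> * q \<tau>)"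
    using nn by (intro delta_integral_mono_upper S tS st i) auto
  show "0 \<le> delta_integral S a t (\<lambda>\<tau>. k t \<tau> * q \<tau>)"
    using nn st by (intro delta_integral_nonneg S tS i) auto
  show "delta_integral S a s (\<lambda>\<tau>. k s \<tau> * q \<tau>) \<le> delta_integral S a s (\<lambda>\<tau>. k t \<tau> * q \<tau>)"
  proof (cases "s = a")
    case True
    then show ?thesis using delta_integral_same S by simp
  next
    case False
    show ?thesis
    proof (rule delta_integral_mono[OF S st(1,3) i[OF s\<kappa>]])
      show "delta_integrable S (\<lambda>\<tau>. k t \<tau> * q \<tau>) a s"
        using delta_integrable_restrict[OF S tS st(1,3,4) i[OF st(2)]] .
      show "k s \<tau> * q \<tau> \<le> k t \<tau> * q \<tau>" if "\<tau> \<in> S" "a \<le> \<tau>" "\<tau> < s" for \<tau>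
        using that False st \<kappa>[of \<tau>] q
        by (intro mult_right_mono admissible_kernel_mono[OF S(1) k nonneg]) auto
    qed
  qed
qed

text \<open>A function with antitone derivative lies below its tangents. Both orders of x and y
  matter, since the argument inserted later may decrease.\<close>

lemma antitone_derivative_tangent:
  fixes \<Psi> \<omega> :: "real \<Rightarrow> real"
  assumes d: "\<And>x. 0 < x \<Longrightarrow> (\<Psi> has_real_derivative 1 / \<omega> x) (at x)"
    and \<omega>: "\<And>x y. 0 < x \<Longrightarrow> x \<le> y \<Longrightarrow> \<omega> x \<le> \<omega> y" "\<And>x. 0 < x \<Longrightarrow> 0 < \<omega> x"
    and xy: "0 < x" "0 < y"
  shows "\<Psi> y - \<Psi> x \<le> (y - x) / \<omega> x"
proof -
  consider "x < y" | "x = y" | "y < x" by linarith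
  then show ?thesis
  proof cases
    case 1
    obtain z where z: "x < z" "z < y" "\<Psi> y - \<Psi> x = (y - x) * (1 / \<omega> z)"
      using MVT2[OF 1, of \<Psi> "\<lambda>z. 1 / \<omega> z"] d xy by auto
    have "1 / \<omega> z \<le> 1 / \<omega> x"
      using \<omega>(1)[of x z] \<omega>(2)[of x] xy z by (intro divide_left_mono) auto
    then have "(y - x) * (1 / \<omega> z) \<le> (y - x) * (1 / \<omega> x)" using 1 by (intro mult_left_mono) auto
    then show ?thesis using z by simp
  next
    case 3
    obtain z where z: "y < z" "z < x" "\<Psi> x - \<Psi> y = (x - y) * (1 / \<omega> z)"
      using MVT2[OF 3, of \<Psi> "\<lambda>z. 1 / \<omega> z"] d xy by auto
    have "1 / \<omega> x \<le> 1 / \<omega> z"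
      using \<omega>(1)[of z x] \<omega>(2)[of z] xy z by (intro divide_left_mono) auto
    then have "(x - y) * (1 / \<omega> x) \<le> (x - y) * (1 / \<omega> z)" using 3 by (intro mult_left_mono) auto
    then show ?thesis using z by (simp add: minus_divide_left diff_divide_distrib)
  qed auto
qed

text \<open>A Bihari inequality with forcing term \<open>q\<close>. Integrating \<open>q\<close>
  into the constant \<zeta> beforehand leaves a separable inequality, for which \<Psi> is the
  separating substitution.\<close>

lemma delta_bihari:
  assumes S: "closed S" "c \<in> S" "d \<in> S" "c \<le> d"
    and G: "pre_antiderivative (S \<inter> {c..d}) g G" "G c = 0"
    and K: "pre_antiderivative (S \<inter> {c..d}) q K" "K c = 0"
    and H: "pre_antiderivative (S \<inter> {c..d}) h H" "H c = 0"
    and nonneg: "\<And>t. t \<in> S \<Longrightarrow> c \<le> t \<Longrightarrow> t < d \<Longrightarrow> 0 \<le> g t \<and> 0 \<le> q t \<and> 0 \<le> h t"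
    and le: "\<And>t. t \<in> S \<Longrightarrow> c \<le> t \<Longrightarrow> t < d \<Longrightarrow> g t \<le> q t + h t * \<omega> (G t)"
    and \<zeta>: "K d \<le> \<zeta>" "0 < \<zeta>"
    and \<omega>: "\<And>x y. 0 \<le> x \<Longrightarrow> x \<le> y \<Longrightarrow> \<omega> x \<le> \<omega> y" "\<And>x. 0 < x \<Longrightarrow> 0 < \<omega> x"
    and \<Psi>: "\<And>x. 0 < x \<Longrightarrow> (\<Psi> has_real_derivative 1 / \<omega> x) (at x)"
  shows "\<Psi> (max (G d) \<zeta>) \<le> \<Psi> \<zeta> + H d"
proof -
  let ?S = "S \<inter> {c..d}"
  have S': "closed ?S" "?S \<subseteq> {c..d}" "c \<in> ?S" "d \<in> ?S" using S by auto
  have mono: "X s \<le> X t" if X: "pre_antiderivative ?S x X"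
    and nn: "\<And>t. t \<in> S \<Longrightarrow> c \<le> t \<Longrightarrow> t < d \<Longrightarrow> 0 \<le> x t"
    and st: "s \<in> ?S" "t \<in> ?S" "s \<le> t" for x X s t
  proof -
    have S'': "closed (?S \<inter> {s..t})" "?S \<inter> {s..t} \<subseteq> {s..t}" "s \<in> ?S \<inter> {s..t}" "t \<in> ?S \<inter> {s..t}"
      using st S by auto
    have "0 * t - 0 * s \<le> X t - X s"
      using nn st
      by (intro pre_antiderivative_mono[OF S'' pre_antiderivative_linear[OF S''(1)]
            pre_antiderivative_restrict[OF S'(1) X st(2)]]) auto
    then show ?thesis by simp
  qed
  \<comment> \<open>Subtracting \<open>K\<close> removes \<open>q\<close> from the slope, and adding
    \<zeta>, an upper bound of \<open>K\<close>, keeps \<open>y\<close> above \<open>G\<close>. But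
    \<open>y\<close> may decrease and is only known to be nonnegative, whereas \<Psi> needs a
    positive argument; hence the maximum with \<zeta>.\<close>
  define y where "y t = G t - K t + \<zeta>" for t
  define m where "m t = max (y t) \<zeta>" for t
  have m_pos: "0 < m t" for t using \<zeta> by (simp add: m_def)
  have G_nonneg: "0 \<le> G t" if "t \<in> ?S" for t
    using mono[OF G(1) _ S'(3) that] nonneg that G(2) by simp
  have G_le_y: "G t \<le> y t" if "t \<in> ?S" for t
    using mono[OF K(1) _ that S'(4)] nonneg that \<zeta> unfolding y_def by fastforce
  have tangent: "\<Psi> z - \<Psi> x \<le> (z - x) / \<omega> x" if "0 < x" "0 < z" for x z
    using \<Psi> \<omega> that by (intro antitone_derivative_tangent) auto
  obtain E1 where E1: "countable E1" "\<forall>t\<in>E1. ts_sigma ?S t = t"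
      "\<forall>t \<in> ts_kappa ?S - E1. has_delta_derivative ?S G (g t) t" and cG: "continuous_on ?S G"
    using G(1) unfolding pre_antiderivative_def by auto
  obtain E2 where E2: "countable E2" "\<forall>t\<in>E2. ts_sigma ?S t = t"
      "\<forall>t \<in> ts_kappa ?S - E2. has_delta_derivative ?S K (q t) t" and cK: "continuous_on ?S K"
    using K(1) unfolding pre_antiderivative_def by auto
  obtain E3 where E3: "countable E3" "\<forall>t\<in>E3. ts_sigma ?S t = t"
      "\<forall>t \<in> ts_kappa ?S - E3. has_delta_derivative ?S H (h t) t" and cH: "continuous_on ?S H"
    using H(1) unfolding pre_antiderivative_def by auto
  define F where "F t = \<Psi> (m t) - H t" for t
  have "F d \<le> F c"
  proof (rule nonincreasing_if_right_increments[OF S', of F "E1 \<union> E2 \<union> E3"])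
    have "continuous_on ?S m"
      unfolding m_def y_def using cG cK by (intro continuous_intros)
    moreover have "continuous_on {0<..} \<Psi>"
      using \<Psi> DERIV_isCont by (intro continuous_at_imp_continuous_on) auto
    ultimately have "continuous_on ?S (\<lambda>t. \<Psi> (m t))"
      using continuous_on_compose2[of "{0<..}" \<Psi> ?S m] m_pos by (simp add: image_subset_iff)
    then show "continuous_on ?S F"
      unfolding F_def using cH by (intro continuous_intros)
    show "countable (E1 \<union> E2 \<union> E3)" using E1 E2 E3 by auto
    show "ts_sigma ?S t = t" if "t \<in> E1 \<union> E2 \<union> E3" for t using that E1 E2 E3 by auto
    fix t \<epsilon> :: real
    assume t: "t \<in> ?S" "t < d" "t \<notin> E1 \<union> E2 \<union> E3" and \<epsilon>: "0 < \<epsilon>"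
    let ?w = "\<omega> (m t)"
    have w: "0 < ?w" using m_pos \<omega> by simp
    have t\<kappa>: "t \<in> ts_kappa ?S" using ts_kappa_less[OF t(1) S'(4) t(2)] .
    have "has_delta_derivative ?S (\<lambda>x. G x - K x) (g t - q t) t"
      using E1 E2 t t\<kappa> by (intro has_delta_derivative_diff) auto
    \<comment> \<open>The tangent inequality divides by \<open>?w\<close>, so this error and that of
      \<open>H\<close> contribute \<open>\<epsilon> / 2\<close> each.\<close>
    from has_delta_derivative_right_increment[OF S'(1) this t(1) S'(4) t(2), of "\<epsilon> * ?w / 2"]
    obtain s1 where s1: "s1 \<in> ?S" "t < s1" "\<And>r. r \<in> ?S \<Longrightarrow> t < r \<Longrightarrow> r \<le> s1 \<Longrightarrow>
        \<bar>G r - K r - (G t - K t) - (g t - q t) * (r - t)\<bar> \<le> \<epsilon> * ?w / 2 * (r - t)"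
      using \<epsilon> w by (metis half_gt_zero mult_pos_pos)
    have "has_delta_derivative ?S H (h t) t" using E3 t t\<kappa> by auto
    from has_delta_derivative_right_increment[OF S'(1) this t(1) S'(4) t(2), of "\<epsilon> / 2"]
    obtain s2 where s2: "s2 \<in> ?S" "t < s2" "\<And>r. r \<in> ?S \<Longrightarrow> t < r \<Longrightarrow> r \<le> s2 \<Longrightarrow>
        \<bar>H r - H t - h t * (r - t)\<bar> \<le> \<epsilon> / 2 * (r - t)"
      using \<epsilon> by (metis half_gt_zero)
    have h: "0 \<le> h t" using nonneg t by auto
    have "\<omega> (G t) \<le> ?w"
      using G_nonneg[OF t(1)] G_le_y[OF t(1)] by (intro \<omega>) (auto simp: m_def)
    then have slope: "g t - q t \<le> h t * ?w"
      using le[of t] t mult_left_mono[OF _ h, of "\<omega> (G t)" ?w] by auto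
    have "F r - F t \<le> \<epsilon> * (r - t)" if r: "r \<in> ?S" "t < r" "r \<le> min s1 s2" for r
    proof -
      have "y r - y t \<le> (g t - q t) * (r - t) + \<epsilon> * ?w / 2 * (r - t)"
        using abs_le_D1[OF s1(3)[of r]] r unfolding y_def by linarith
      also have "\<dots> \<le> h t * ?w * (r - t) + \<epsilon> * ?w / 2 * (r - t)"
        using slope r by (intro add_right_mono mult_right_mono) auto
      finally have 1: "y r - y t \<le> (h t + \<epsilon> / 2) * (r - t) * ?w"
        by (simp add: algebra_simps)
      \<comment> \<open>A nonnegative bound on the increments of \<open>y\<close> is inherited by
        its maximum with a constant.\<close>
      have "0 \<le> (h t + \<epsilon> / 2) * (r - t) * ?w" using h \<epsilon> w r by simp
      with 1 have "m r - m t \<le> (h t + \<epsilon> / 2) * (r - t) * ?w"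
        unfolding m_def by (auto simp: max_def)
      then have "(m r - m t) / ?w \<le> (h t + \<epsilon> / 2) * (r - t)"
        using w by (simp add: divide_le_eq)
      with tangent[OF m_pos[of t] m_pos[of r]]
      have "\<Psi> (m r) - \<Psi> (m t) \<le> (h t + \<epsilon> / 2) * (r - t)" by simp
      moreover have "h t * (r - t) - \<epsilon> / 2 * (r - t) \<le> H r - H t"
        using abs_le_D2[OF s2(3)[of r]] r by simp
      moreover have "\<epsilon> / 2 * (r - t) + \<epsilon> / 2 * (r - t) = \<epsilon> * (r - t)" by simp
      ultimately show ?thesis unfolding F_def distrib_right by linarith
    qed
    then show "\<exists>s\<in>?S. t < s \<and> (\<forall>r\<in>?S. t < r \<and> r \<le> s \<longrightarrow> F r - F t \<le> \<epsilon> * (r - t))"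
      using s1 s2 by (intro bexI[of _ "min s1 s2"]) (auto simp: min_def)
  qed
  moreover have "m c = \<zeta>" by (simp add: m_def y_def G K)
  moreover have "\<Psi> (max (G d) \<zeta>) \<le> \<Psi> (m d)"
  proof (cases "max (G d) \<zeta> = m d")
    case False
    moreover have "max (G d) \<zeta> \<le> m d" using G_le_y[OF S'(4)] by (auto simp: m_def)
    ultimately have "max (G d) \<zeta> < m d" by linarith
    then show ?thesis
    proof (rule less_imp_le[OF DERIV_pos_imp_increasing])
      fix x assume "max (G d) \<zeta> \<le> x"
      then have "0 < x" using \<zeta> by simp
      then show "\<exists>D. (\<Psi> has_real_derivative D) (at x) \<and> 0 < D"
        using \<Psi> \<omega>(2) by (intro exI[of _ "1 / \<omega> x"]) simp
    qed
  qed simp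
  ultimately show ?thesis by (simp add: F_def H)
qed

text \<open>The condition \<open>0 < \<zeta>\<close> belongs to the domain condition: \<Psi> is
  defined on the positive reals, so only then is \<open>\<Psi> \<zeta>\<close> meaningful. For the
  same reason the inverse is taken on \<open>{0<..}\<close>.\<close>

theorem theorem1:
  fixes TT T :: "real set" and a b x0 \<zeta> :: real
    and u f A p \<Phi> W \<Psi> g :: "real \<Rightarrow> real"
    and k :: "real \<Rightarrow> real \<Rightarrow> real"
  assumes TT: "time_scale TT" and ab: "a \<in> TT" "b \<in> TT" "a < b"
  defines "T \<equiv> TT \<inter> {a..b}"
  assumes u: "rd_continuous_on T T u" "\<forall>t\<in>T. 0 \<le> u t"
    and f: "rd_continuous_on T (ts_kappa T) f" "\<forall>t \<in> ts_kappa T. 0 \<le> f t"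
    and k: "admissible_kernel T a k"
    and k_nonneg: "\<forall>t\<in>T. \<forall>s \<in> ts_kappa T. s \<le> t \<longrightarrow> 0 \<le> k t s"
    and kdelta_nonneg: "\<forall>t \<in> ts_kappa T. \<forall>s \<in> ts_kappa T.
          s \<le> t \<and> delta_differentiable T (\<lambda>x. k x s) t \<longrightarrow> 0 \<le> kdelta T k t s"
    and k_nonzero: "\<exists>t \<in> ts_kappa T. \<exists>s \<in> ts_kappa (ts_kappa T). k t s \<noteq> 0"
    and \<Phi>: "continuous_on {0..} \<Phi>" "\<forall>x\<ge>0. 0 \<le> \<Phi> x" "mono_on {0..} \<Phi>" "\<forall>x>0. 0 < \<Phi> x"
    and \<Phi>_subadd: "\<forall>x\<ge>0. \<forall>y\<ge>0. \<Phi> (x + y) \<le> \<Phi> x + \<Phi> y"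
    and \<Phi>_submult: "\<forall>x\<ge>0. \<forall>y\<ge>0. \<Phi> (x * y) \<le> \<Phi> x * \<Phi> y"
    and W: "continuous_on {0..} W" "\<forall>x\<ge>0. 0 \<le> W x" "mono_on {0..} W" "\<forall>x>0. 0 < W x"
    and A: "rd_continuous_on T T A" "mono_on T A" "\<forall>t\<in>T. 0 < A t"
    and x0: "0 < x0"
    and ineq: "\<forall>t\<in>T. u t \<le> A t + delta_integral T a t (\<lambda>s. f s * u s)
          + delta_integral T a t
              (\<lambda>s. f s * W (delta_integral T a s (\<lambda>\<tau>. k s \<tau> * \<Phi> (u \<tau>))))"
  defines "p \<equiv> \<lambda>t. 1 + delta_integral T a t (\<lambda>s. f s * ts_exp T f t (ts_sigma T s))"
    and "\<zeta> \<equiv> delta_integral T a (ts_rho T b) (\<lambda>s. k (ts_rho T b) s * \<Phi> (p s * A s))"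
    and "\<Psi> \<equiv> \<lambda>x. LBINT s=x0..x. 1 / \<Phi> (W s)"
    and "g \<equiv> \<lambda>t. \<Psi> \<zeta> + delta_integral T a t
               (\<lambda>s. k t s * \<Phi> (p s) * \<Phi> (delta_integral T a s f))"
  assumes integrals_exist:
      "\<forall>t\<in>T. delta_integrable T f a t"
      "\<forall>t\<in>T. delta_integrable T (\<lambda>s. f s * u s) a t"
      "\<forall>s \<in> ts_kappa T. delta_integrable T (\<lambda>\<tau>. k s \<tau> * \<Phi> (u \<tau>)) a s"
      "\<forall>t\<in>T. delta_integrable T
          (\<lambda>s. f s * W (delta_integral T a s (\<lambda>\<tau>. k s \<tau> * \<Phi> (u \<tau>)))) a t"
      "\<forall>t\<in>T. delta_integrable T (\<lambda>s. f s * ts_exp T f t (ts_sigma T s)) a t"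
      "delta_integrable T (\<lambda>s. k (ts_rho T b) s * \<Phi> (p s * A s)) a (ts_rho T b)"
      "\<forall>t \<in> ts_kappa T. delta_integrable T
          (\<lambda>s. k t s * \<Phi> (p s) * \<Phi> (delta_integral T a s f)) a t"
      "\<forall>t\<in>T. 0 < \<zeta> \<and> g (ts_rho T t) \<in> \<Psi> ` {0<..} \<longrightarrow>
          delta_integrable T (\<lambda>s. f s * W (inv_into {0<..} \<Psi> (g s))) a t"
  shows "\<forall>t\<in>T. 0 < \<zeta> \<and> g (ts_rho T t) \<in> \<Psi> ` {0<..} \<longrightarrow>
           u t \<le> p t * A t + p t * delta_integral T a t (\<lambda>s. f s * W (inv_into {0<..} \<Psi> (g s)))"
proof -
  have S: "closed T" "T \<subseteq> {a..b}" "a \<in> T" "b \<in> T"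
    using TT ab by (auto simp: T_def time_scale_def)
  have Tab: "T \<inter> {a..b} = T" using S by auto
  have ge_a: "a \<le> t" and le_b: "t \<le> b" if "t \<in> T" for t using S that by auto
  have \<kappa>T: "t \<in> T" if "t \<in> ts_kappa T" for t using that ts_kappa_subset by auto
  have \<kappa>: "t \<in> ts_kappa T" if "t \<in> T" "s \<in> T" "t < s" for s t
    using ts_kappa_less that by auto
  have a\<kappa>: "a \<in> ts_kappa T" using \<kappa> S ab by blast
  have f_nn: "0 \<le> f s" if "s \<in> T" "t \<in> T" "s < t" for s t
    using f(2) \<kappa> that by blast

  \<comment> \<open>Identification of \<open>p\<close> with an exponential\<close>
  obtain F where F: "pre_antiderivative T f F"
    using delta_integrableE[OF S(1,3,4) ge_a[OF S(4)] integrals_exist(1)[rule_format, OF S(4)]] Tab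
    by metis
  have dF: "has_delta_derivative T F (f t) t" if "t \<in> ts_kappa T" for t
    using pre_antiderivative_rd_continuous[OF S(1) F f(1) that] .
  have monoF: "F s \<le> F t" if st: "s \<in> T" "t \<in> T" "s \<le> t" for s t
  proof -
    have S': "closed (T \<inter> {s..t})" "T \<inter> {s..t} \<subseteq> {s..t}" "s \<in> T \<inter> {s..t}" "t \<in> T \<inter> {s..t}"
      using S st by auto
    have "0 * t - 0 * s \<le> F t - F s"
      using f_nn st by (intro pre_antiderivative_mono[OF S' pre_antiderivative_linear[OF S'(1)]
            pre_antiderivative_restrict[OF S(1) F st(2)]]) auto
    then show ?thesis by simp
  qed
  obtain L where L: "exponent_of T f L"
    using exponent_of_exists[OF S(1-3) _ monoF dF] F by (auto simp: pre_antiderivative_def)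
  have p_eq: "p t = exp (L t - L a)" if "t \<in> T" for t
    unfolding p_def using delta_integral_ts_exp[OF S(1) L S(3) that] ge_a[OF that] by simp
  have p_pos: "0 < p t" if "t \<in> T" for t using p_eq that by simp

  \<comment> \<open>Monotone integrals and the linear Gronwall step\<close>
  define v where "v s = delta_integral T a s (\<lambda>\<tau>. k s \<tau> * \<Phi> (u \<tau>))" for s
  define I where "I t = delta_integral T a t f" for t
  define J where "J t = delta_integral T a t (\<lambda>s. f s * W (v s))" for t
  have \<Phi>u: "0 \<le> \<Phi> (u \<tau>)" if "\<tau> \<in> ts_kappa T" for \<tau> using \<Phi>(2) u(2) \<kappa>T that by auto
  note v_mono = kernel_integral_mono[OF S(1,3) k k_nonneg kdelta_nonneg \<Phi>u integrals_exist(3)[rule_format]]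
  have v_le: "v s \<le> v t" if "s \<in> T" "t \<in> ts_kappa T" "s \<le> t" for s t
    unfolding v_def using v_mono(1,2)[of s t] that ge_a by force
  have v_nn: "0 \<le> v t" if "t \<in> ts_kappa T" for t
    unfolding v_def using v_mono(3)[of a t] that S ge_a \<kappa>T by auto
  have I_nn: "0 \<le> I t" if "t \<in> T" for t
    unfolding I_def using f_nn that integrals_exist(1) ge_a
    by (intro delta_integral_nonneg S) auto
  have J_int: "delta_integrable T (\<lambda>s. f s * W (v s)) a t" if "t \<in> T" for t
    using integrals_exist(4) that by (simp add: v_def)
  have fW: "0 \<le> f s * W (v s)" if "s \<in> T" "t \<in> T" "s < t" for s t
    using f_nn that W(2) v_nn \<kappa> by (metis mult_nonneg_nonneg)
  have J_nn: "0 \<le> J t" if "t \<in> T" for t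
    unfolding J_def using fW that ge_a by (intro delta_integral_nonneg S J_int) auto
  have J_mono: "J s \<le> J t" if "s \<in> T" "t \<in> T" "s \<le> t" for s t
    unfolding J_def using fW that ge_a by (intro delta_integral_mono_upper S J_int) auto

  have u_le: "u t \<le> p t * (A t + J t)" if t: "t \<in> T" for t
  proof -
    obtain U where U: "pre_antiderivative (T \<inter> {a..t}) (\<lambda>s. f s * u s) U" "U a = 0"
      "\<And>s. s \<in> T \<Longrightarrow> a \<le> s \<Longrightarrow> s \<le> t \<Longrightarrow> delta_integral T a s (\<lambda>s. f s * u s) = U s"
      using delta_integrableE[OF S(1,3) t ge_a[OF t] integrals_exist(2)[rule_format, OF t]] by metis
    \<comment> \<open>\<open>A\<close> and \<open>J\<close> are nondecreasing, so their values at
      the end point t can play the constant in Gronwall's inequality.\<close>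
    have le: "u s \<le> (A t + J t) + U s" if "s \<in> T" "a \<le> s" "s \<le> t" for s
      using ineq[rule_format, OF that(1)] U(3)[OF that] J_mono[OF that(1) t that(3)]
        mono_onD[OF A(2) that(1) t that(3)] by (simp add: J_def v_def)
    have "(A t + J t) + U t \<le> (A t + J t) * exp (L t - L a)"
      using le f_nn t by (intro delta_gronwall[OF S(1) L S(3) t ge_a[OF t] _ U(1,2)]) auto
    with le[of t] t ge_a[OF t] p_eq[OF t] show ?thesis by (simp add: mult.commute)
  qed

  \<comment> \<open>The transformation \<Psi>\<close>
  define \<omega> where "\<omega> x = \<Phi> (W x)" for x
  have \<Phi>_mono: "\<Phi> x \<le> \<Phi> y" if "0 \<le> x" "x \<le> y" for x y
    using mono_onD[OF \<Phi>(3), of x y] that by auto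
  have W_mono: "W x \<le> W y" if "0 \<le> x" "x \<le> y" for x y
    using mono_onD[OF W(3), of x y] that by auto
  have \<omega>_mono: "\<omega> x \<le> \<omega> y" if "0 \<le> x" "x \<le> y" for x y
    unfolding \<omega>_def using that W(2) by (intro \<Phi>_mono W_mono) auto
  have \<omega>_pos: "0 < \<omega> x" if "0 < x" for x
    unfolding \<omega>_def using that W(4) \<Phi>(4) by auto
  have \<omega>_cont: "continuous_on {0..} \<omega>"
    unfolding \<omega>_def using W(2) by (intro continuous_on_compose2[OF \<Phi>(1) W(1)]) auto
  have d\<Psi>: "(\<Psi> has_real_derivative 1 / \<omega> x) (at x)" if x: "0 < x" for x
  proof -
    \<comment> \<open>A compact interval around x and \<open>x0\<close> that stays off 0, where
      \<open>1 / \<omega>\<close> may blow up, and has x in its interior.\<close>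
    define l r where "l = min x x0 / 2" and "r = max x x0 + 1"
    have lr: "0 < l" "l < x" "x < r" "l \<le> x0" "x0 \<le> r" using x x0 by (auto simp: l_def r_def)
    have "\<omega> y \<noteq> 0" if "y \<in> {l..r}" for y using \<omega>_pos[of y] lr that by auto
    moreover have "continuous_on {l..r} \<omega>"
      using lr by (intro continuous_on_subset[OF \<omega>_cont]) auto
    ultimately have "continuous_on {l..r} (\<lambda>y. 1 / \<omega> y)" by (intro continuous_intros) auto
    from interval_integral_FTC2[OF lr(4,5) this, of x] lr
    have "(\<Psi> has_vector_derivative 1 / \<omega> x) (at x within {l..r})"
      unfolding \<Psi>_def \<omega>_def by auto
    then show ?thesis
      using lr at_within_Icc_at[of l x r]
      by (simp add: has_real_derivative_iff_has_vector_derivative)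
  qed
  have \<Psi>_less: "\<Psi> x < \<Psi> y" if "0 < x" "x < y" for x y
  proof (rule DERIV_pos_imp_increasing[OF that(2)])
    fix z assume "x \<le> z" "z \<le> y"
    then have "0 < z" using that by simp
    then show "\<exists>D. (\<Psi> has_real_derivative D) (at z) \<and> 0 < D"
      using d\<Psi> \<omega>_pos by (intro exI[of _ "1 / \<omega> z"]) auto
  qed
  have \<Psi>_cont: "continuous_on {x..y} \<Psi>" if "0 < x" for x y
    using d\<Psi>[THEN DERIV_isCont] that by (intro continuous_at_imp_continuous_on) auto

  \<comment> \<open>Monotonicity of \<open>g\<close>\<close>
  define h where "h \<tau> = \<Phi> (p \<tau>) * \<Phi> (I \<tau>)" for \<tau>
  have h_nn: "0 \<le> h \<tau>" if "\<tau> \<in> ts_kappa T" for \<tau>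
    unfolding h_def using \<Phi>(2) less_imp_le[OF p_pos[OF \<kappa>T[OF that]]] I_nn[OF \<kappa>T[OF that]] by simp
  have h_int: "delta_integrable T (\<lambda>\<tau>. k t \<tau> * h \<tau>) a t" if "t \<in> ts_kappa T" for t
    using integrals_exist(7) that by (simp add: h_def I_def mult.assoc)
  have g_eq: "g t = \<Psi> \<zeta> + delta_integral T a t (\<lambda>\<tau>. k t \<tau> * h \<tau>)" for t
    by (simp add: g_def h_def I_def mult.assoc)
  note h_mono = kernel_integral_mono[OF S(1,3) k k_nonneg kdelta_nonneg h_nn h_int]
  have g_le: "g s \<le> g t" if "s \<in> T" "t \<in> ts_kappa T" "s \<le> t" for s t
    unfolding g_eq using h_mono(1,2)[of s t] that ge_a by force
  have g_ge: "\<Psi> \<zeta> \<le> g t" if "t \<in> ts_kappa T" for t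
    unfolding g_eq using h_mono(3)[of a t] that S ge_a \<kappa>T by auto

  \<comment> \<open>Backward jumps\<close>
  have \<rho>T: "ts_rho T t \<in> ts_kappa T" "ts_rho T t \<le> t" "\<And>s. s \<in> T \<Longrightarrow> s < t \<Longrightarrow> s \<le> ts_rho T t"
    if t: "t \<in> T" for t
  proof -
    have 1: "ts_rho T t \<in> T \<and> ts_rho T t \<le> t \<and> (\<forall>s\<in>T. s < t \<longrightarrow> s \<le> ts_rho T t)"
    proof (cases "a < t")
      case True
      then show ?thesis using ts_rho_props[OF S(1,3)] by blast
    next
      case False
      then have "t = a" using ge_a[OF t] by simp
      moreover from this have "ts_rho T t = a" using ge_a by (force simp: ts_rho_def)
      ultimately show ?thesis using S ge_a by force
    qed
    then show "ts_rho T t \<le> t" "\<And>s. s \<in> T \<Longrightarrow> s < t \<Longrightarrow> s \<le> ts_rho T t" by auto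
    show "ts_rho T t \<in> ts_kappa T"
    proof (cases "ts_rho T t < b")
      case True
      then show ?thesis using 1 S \<kappa> by blast
    next
      case False
      moreover from this have "t = b" using 1 le_b[OF t] by simp
      ultimately have "t = b" "ts_rho T b = b" using 1 by auto
      then show ?thesis using S by (simp add: ts_kappa_def)
    qed
  qed
  \<comment> \<open>This makes the kernel frozen at \<open>ts_rho T b\<close> a majorant of the one
    frozen at any t > a in \<open>ts_kappa T\<close>.\<close>
  have \<kappa>_le: "t \<le> ts_rho T b" if "t \<in> ts_kappa T" for t
  proof (cases "t = b")
    case True
    then have "\<not> ts_rho T b < b" using that le_b by (auto simp: ts_kappa_def)
    then show ?thesis using True by simp
  next
    case False
    then show ?thesis using \<rho>T(3)[OF S(4), of t] le_b[of t] \<kappa>T[OF that] by simp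
  qed

  \<comment> \<open>The nonlinear bound for \<open>v\<close>\<close>
  have v_bound: "\<Psi> (max (v t) \<zeta>) \<le> g t" if t: "t \<in> ts_kappa T" and \<zeta>: "0 < \<zeta>" for t
  proof (cases "t = a")
    case True
    \<comment> \<open>Kernels can be compared only beyond \<open>a\<close>, so this point is treated
      apart.\<close>
    then have "v t = 0" using delta_integral_same[OF S(1,3)] by (simp add: v_def)
    then show ?thesis using g_ge[OF t] \<zeta> by simp
  next
    case False
    let ?B = "ts_rho T b"
    note tT = \<kappa>T[OF t] and B = \<rho>T(1)[OF S(4)]
    have at: "a < t" using False ge_a[OF tT] by simp
    have tB: "t \<le> ?B" using \<kappa>_le[OF t] .
    obtain G where G: "pre_antiderivative (T \<inter> {a..t}) (\<lambda>\<tau>. k t \<tau> * \<Phi> (u \<tau>)) G" "G a = 0"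
      "\<And>s. s \<in> T \<Longrightarrow> a \<le> s \<Longrightarrow> s \<le> t \<Longrightarrow> delta_integral T a s (\<lambda>\<tau>. k t \<tau> * \<Phi> (u \<tau>)) = G s"
      using delta_integrableE[OF S(1,3) tT ge_a[OF tT] integrals_exist(3)[rule_format, OF t]] by metis
    obtain K where "pre_antiderivative (T \<inter> {a..?B}) (\<lambda>s. k ?B s * \<Phi> (p s * A s)) K"
      and K: "K a = 0"
      "\<And>s. s \<in> T \<Longrightarrow> a \<le> s \<Longrightarrow> s \<le> ?B \<Longrightarrow>
        delta_integral T a s (\<lambda>s. k ?B s * \<Phi> (p s * A s)) = K s"
      "\<And>s. s \<in> T \<Longrightarrow> a \<le> s \<Longrightarrow> s \<le> ?B \<Longrightarrow>
        pre_antiderivative (T \<inter> {a..s}) (\<lambda>s. k ?B s * \<Phi> (p s * A s)) K"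
      by (rule delta_integrableE[OF S(1,3) \<kappa>T[OF B] ge_a[OF \<kappa>T[OF B]] integrals_exist(6)]) (rule that)
    have \<zeta>K: "\<zeta> = K ?B"
      unfolding \<zeta>_def using K(2)[OF \<kappa>T[OF B] ge_a[OF \<kappa>T[OF B]]] by simp
    obtain H where H: "pre_antiderivative (T \<inter> {a..t}) (\<lambda>\<tau>. k t \<tau> * h \<tau>) H" "H a = 0"
      "delta_integral T a t (\<lambda>\<tau>. k t \<tau> * h \<tau>) = H t"
      using delta_integrableE[OF S(1,3) tT ge_a[OF tT] h_int[OF t]] tT ge_a by (metis order_refl)
    have pA: "0 \<le> p s * A s" if "s \<in> T" for s
      using p_pos A(3) that by (simp add: less_imp_le)
    have k_nn: "0 \<le> k r s" if "r \<in> T" "s \<in> ts_kappa T" "s \<le> r" for r s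
      using k_nonneg that by blast
    \<comment> \<open>The first argument of the kernel is frozen at \<open>t\<close>, so no differentiation under the integral
      is needed.\<close>
    have "\<Psi> (max (G t) \<zeta>) \<le> \<Psi> \<zeta> + H t"
    proof (rule delta_bihari[OF S(1,3) tT ge_a[OF tT] G(1,2) K(3)[OF tT ge_a[OF tT] tB] K(1) H(1,2) _ _ _ \<zeta> \<omega>_mono \<omega>_pos d\<Psi>])
      have "K t \<le> K ?B"
        unfolding K(2)[OF tT ge_a[OF tT] tB, symmetric]
          K(2)[OF \<kappa>T[OF B] ge_a[OF \<kappa>T[OF B]] order_refl, symmetric]
      proof (rule delta_integral_mono_upper[OF S(1,3) \<kappa>T[OF B] tT ge_a[OF tT] tB integrals_exist(6)])
        fix s assume s: "s \<in> T" "s < ?B"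
        show "0 \<le> k ?B s * \<Phi> (p s * A s)"
          using k_nn[OF \<kappa>T[OF B] \<kappa>[OF s(1) \<kappa>T[OF B] s(2)]] s \<Phi>(2) pA[OF s(1)] by simp
      qed
      then show "K t \<le> \<zeta>" using \<zeta>K by simp
      fix s assume s: "s \<in> T" "a \<le> s" "s < t"
      then have s\<kappa>: "s \<in> ts_kappa T" using \<kappa> tT by blast
      have kt: "0 \<le> k t s" and kB: "0 \<le> k ?B s"
        using k_nn s s\<kappa> tT \<kappa>T[OF B] tB by auto
      then show "0 \<le> k t s * \<Phi> (u s) \<and> 0 \<le> k ?B s * \<Phi> (p s * A s) \<and> 0 \<le> k t s * h s"
        using \<Phi>u[OF s\<kappa>] h_nn[OF s\<kappa>] \<Phi>(2) pA[OF s(1)] by auto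
      have k_le: "k t s \<le> k ?B s"
        using s at s\<kappa> by (intro admissible_kernel_mono[OF S(1) k kdelta_nonneg tT B tB]) auto
      \<comment> \<open>Inside the integrals stands \<open>k s\<close>, in \<open>G\<close> the
        larger \<open>k t\<close>. This domination is what permits \<omega> to be evaluated at
        \<open>G\<close> and closes the inequality.\<close>
      have vG: "v s \<le> G s"
        using v_mono(1)[of s t] s t G(3)[of s] by (simp add: v_def)
      \<comment> \<open>As \<open>v\<close> is nondecreasing, \<open>W (v s)\<close> can be taken
        out of the integral. Submultiplicativity then separates \<open>\<omega> (v s)\<close> from
        the factor \<open>h s\<close>, which no longer involves \<open>u\<close>.\<close>
      have "J s \<le> delta_integral T a s (\<lambda>r. W (v s) * f r)"
        unfolding J_def
      proof (rule delta_integral_mono[OF S(1,3) s(1,2) J_int[OF s(1)]])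
        show "delta_integrable T (\<lambda>r. W (v s) * f r) a s"
          using delta_integral_cmult(1)[OF S(1,3) s(1,2)] integrals_exist(1) s by blast
        show "f r * W (v r) \<le> W (v s) * f r" if r: "r \<in> T" "a \<le> r" "r < s" for r
        proof -
          have "W (v r) \<le> W (v s)"
            using r s(1) s\<kappa> \<kappa> by (intro W_mono v_nn v_le) auto
          then show ?thesis using f_nn[OF r(1) s(1) r(3)] by (simp add: mult_left_mono mult.commute[of "W (v s)"])
        qed
      qed
      also have "\<dots> = W (v s) * I s"
        unfolding I_def using delta_integral_cmult(2)[OF S(1,3) s(1,2)] integrals_exist(1) s by blast
      finally have J: "J s \<le> W (v s) * I s" .
      have Wv: "0 \<le> W (v s)" using W(2) v_nn[OF s\<kappa>] by simp
      have "\<Phi> (u s) \<le> \<Phi> (p s * A s + p s * J s)"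
        using u_le[OF s(1)] u(2) s(1) by (intro \<Phi>_mono) (auto simp: distrib_left)
      also have "\<dots> \<le> \<Phi> (p s * A s) + \<Phi> (p s * J s)"
        using \<Phi>_subadd pA[OF s(1)] p_pos[OF s(1)] J_nn[OF s(1)] by simp
      also have "\<Phi> (p s * J s) \<le> \<Phi> (p s) * \<Phi> (J s)"
        using \<Phi>_submult p_pos[OF s(1)] J_nn[OF s(1)] by simp
      also have "\<dots> \<le> \<Phi> (p s) * (\<omega> (v s) * \<Phi> (I s))"
      proof (rule mult_left_mono)
        have "\<Phi> (J s) \<le> \<Phi> (W (v s) * I s)" using J J_nn[OF s(1)] by (intro \<Phi>_mono)
        also have "\<dots> \<le> \<omega> (v s) * \<Phi> (I s)"
          unfolding \<omega>_def using \<Phi>_submult Wv I_nn[OF s(1)] by simp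
        finally show "\<Phi> (J s) \<le> \<omega> (v s) * \<Phi> (I s)" .
        show "0 \<le> \<Phi> (p s)" using \<Phi>(2) p_pos[OF s(1)] by simp
      qed
      also have "\<dots> = h s * \<omega> (v s)" by (simp add: h_def)
      also have "\<dots> \<le> h s * \<omega> (G s)"
        using h_nn[OF s\<kappa>] v_nn[OF s\<kappa>] vG by (intro mult_left_mono \<omega>_mono)
      finally have "k t s * \<Phi> (u s) \<le> k t s * (\<Phi> (p s * A s) + h s * \<omega> (G s))"
        using kt by (intro mult_left_mono) auto
      \<comment> \<open>Only the forcing term is moved to \<open>?B\<close>, where \<zeta> bounds
        its integral. The other term keeps the first argument t, because its coefficient must
        integrate to the increment in \<open>g t\<close>.\<close>
      also have "\<dots> \<le> k ?B s * \<Phi> (p s * A s) + k t s * h s * \<omega> (G s)"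
        using k_le \<Phi>(2) pA[OF s(1)] by (simp add: distrib_left mult.assoc mult_right_mono)
      finally show "k t s * \<Phi> (u s) \<le> k ?B s * \<Phi> (p s * A s) + k t s * h s * \<omega> (G s)" .
    qed
    moreover have "v t = G t" using G(3)[of t] tT at by (simp add: v_def)
    ultimately show ?thesis by (simp add: g_eq H)
  qed

  \<comment> \<open>Inversion of \<Psi> and conclusion\<close>
  show ?thesis
  proof (intro ballI impI)
    fix t assume t: "t \<in> T" and "0 < \<zeta> \<and> g (ts_rho T t) \<in> \<Psi> ` {0<..}"
    then have \<zeta>: "0 < \<zeta>" and dom: "g (ts_rho T t) \<in> \<Psi> ` {0<..}"
      and int: "delta_integrable T (\<lambda>s. f s * W (inv_into {0<..} \<Psi> (g s))) a t"
      using integrals_exist(8) by auto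
    obtain X where X: "0 < X" "g (ts_rho T t) = \<Psi> X" using dom by auto
    have le: "v s \<le> inv_into {0<..} \<Psi> (g s)" if s: "s \<in> T" "s < t" for s
    proof -
      have s\<kappa>: "s \<in> ts_kappa T" using \<kappa>[OF s(1) t s(2)] .
      \<comment> \<open>The range condition is given at \<open>ts_rho T t\<close> only. Every s < t
        lies at or before that point, so \<open>g s\<close> is between two values of \<Psi> and, by
        the intermediate value theorem, is itself in the range.\<close>
      have g: "\<Psi> \<zeta> \<le> g s" "g s \<le> \<Psi> X"
        using g_ge[OF s\<kappa>] g_le[OF s(1) \<rho>T(1,3)[OF t]] s X by auto
      then have "\<zeta> \<le> X" using \<Psi>_less[OF X(1), of \<zeta>] by linarith
      then obtain y where "\<zeta> \<le> y" "\<Psi> y = g s"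
        using IVT'[OF g _ \<Psi>_cont[OF \<zeta>]] by auto
      then have "g s \<in> \<Psi> ` {0<..}" using \<zeta> by (intro image_eqI[of _ _ y]) auto
      then have x: "\<Psi> (inv_into {0<..} \<Psi> (g s)) = g s" "0 < inv_into {0<..} \<Psi> (g s)"
        using f_inv_into_f[of "g s" \<Psi> "{0<..}"] inv_into_into[of "g s" \<Psi> "{0<..}"] by auto
      then have "\<Psi> (max (v s) \<zeta>) \<le> \<Psi> (inv_into {0<..} \<Psi> (g s))"
        using v_bound[OF s\<kappa> \<zeta>] by simp
      then have "max (v s) \<zeta> \<le> inv_into {0<..} \<Psi> (g s)"
        using \<Psi>_less[OF x(2), of "max (v s) \<zeta>"] by linarith
      then show ?thesis by simp
    qed
    have "J t \<le> delta_integral T a t (\<lambda>s. f s * W (inv_into {0<..} \<Psi> (g s)))"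
      unfolding J_def
    proof (rule delta_integral_mono[OF S(1,3) t ge_a[OF t] J_int[OF t] int])
      fix s assume s: "s \<in> T" "a \<le> s" "s < t"
      show "f s * W (v s) \<le> f s * W (inv_into {0<..} \<Psi> (g s))"
        using v_nn[OF \<kappa>[OF s(1) t s(3)]] le[OF s(1,3)] f_nn[OF s(1) t s(3)]
        by (intro mult_left_mono W_mono)
    qed
    then have "p t * J t \<le> p t * delta_integral T a t (\<lambda>s. f s * W (inv_into {0<..} \<Psi> (g s)))"
      using p_pos[OF t] by simp
    then show "u t \<le> p t * A t + p t * delta_integral T a t (\<lambda>s. f s * W (inv_into {0<..} \<Psi> (g s)))"
      using u_le[OF t] by (simp add: distrib_left)
  qed
qed

end
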